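(* Let $c$ be an invariant complexity measure and $\mathcal{C}$ the set of p-families $(g_n)$ with $c(g_n)$ polynomially bounded in $n$. Then $I(\mathcal{C})\cap\mathsf{metaVQP}$ contains a sequence that is not eventually zero if and only if $I(\mathcal{C})\cap\mathsf{metaVQP}\cap\mathsf{Isotypic}$ contains a sequence that is not eventually zero. (The former condition is what it means for $\mathcal{C}$ to have algebraic natural proofs.)
   Context: All polynomials are over $\mathbb{C}$ in variables $x_1,x_2,\dots$. A p-family is a sequence of polynomials whose number of variables and degree are polynomially bounded in $n$. A complexity measure $c$ assigns a natural number to each polynomial; it is invariant if $c(g\cdot f)=c(f)$ for every $f\in\mathbb{C}[x_1,\dots,x_k]$, $g\in\mathrm{GL}_k$, where $(g\cdot f)(x)=f(g^{-1}x)$. A metapolynomial of format $(\delta,d,k)$ is a homogeneous degree-$\delta$ polynomial in variables $c_\mu$ ($\mu\in\mathbb{N}^k$, $|\mu|=d$), evaluated at a polynomial $f$ by substituting for $c_\mu$ the coefficient of $x^\mu$ in $f$. $\mathrm{GL}_k$ acts on such metapolynomials by $(g\cdot\Delta)(f)=\Delta(g^{-1}\cdot f)$ for $f\in\mathbb{C}[x_1,\dots,x_k]_d$. For a partition $\lambda$ of $\delta d$ with at most $k$ parts, the $\lambda$-isotypic component is the sum of all irreducible $\mathrm{GL}_k$-subrepresentations containing a nonzero $\Delta$ with $g\cdot\Delta=t_1^{\lambda_1}\cdots t_k^{\lambda_k}\Delta$ for all invertible upper triangular $g$ with diagonal $(t_1,\dots,t_k)$. $\mathsf{Isotypic}$ is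 the set of sequences $(\Delta_n)$ in which each $\Delta_n$ lies in a single isotypic component. Let $X_{d,r}$ be the set of homogeneous degree-$d$ polynomials with $c(f)\le r$. $I(\mathcal{C})$ is the set of sequences $(\Delta_n)$, $\Delta_n$ of format $(\delta(n),n,k(n))$, such that for every polynomially bounded $r(n)$, $\Delta_n$ vanishes identically on $X_{n,r(n)}$ for all sufficiently large $n$. Algebraic circuits: directed acyclic graphs with a unique output vertex, input vertices labelled by affine linear metapolynomials, indegree-2 vertices labelled $+$ or $\times$, edges labelled by complex scalars (a gate computes $\alpha_1\Delta_1+\alpha_2\Delta_2$ or $\alpha_1\alpha_2\Delta_1\Delta_2$); size is the number of vertices, and $\mathrm{cc}(\Delta)$ is the minimum size of a circuit computing $\Delta$. $\mathsf{metaVQP}$ is the set of sequences $(\Delta_n)$ of metapolynomials of format $(\delta(n),n,k(n))$ with $k(n)$ polynomially bounded in $n$, and, writing $N(n)=\binom{k(n)+n-1}{n}$, with $\delta(n)$ polynomially bounded in $N(n)$ and $\mathrm{cc}(\Delta_n)$ bounded by $2^{\mathrm{poly}(\log N(n))}$. *)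

theory Defs
  imports
    "HOL-Library.Poly_Mapping"
    "HOL-Computational_Algebra.Polynomial"
    Complex_Main
    "Jordan_Normal_Form.Matrix"
begin

section \<open>Polynomials with complex coefficients\<close>

text \<open>
  A monomial is a finitely supported exponent vector. The variables \<open>x\<^sub>1, x\<^sub>2, \<dots>\<close> are indexed
  from \<open>0\<close>, so \<open>\<complex>[x\<^sub>1, \<dots>, x\<^sub>k]\<close> uses the indices \<open>{..<k}\<close>.
\<close>

type_synonym 'v cmpoly = "('v \<Rightarrow>\<^sub>0 nat) \<Rightarrow>\<^sub>0 complex"

type_synonym cpoly = "nat cmpoly"

definition mdeg :: "('v \<Rightarrow>\<^sub>0 nat) \<Rightarrow> nat" where
  "mdeg m = (\<Sum>v\<in>Poly_Mapping.keys m. Poly_Mapping.lookup m v)"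

definition const :: "complex \<Rightarrow> 'v cmpoly" where
  "const a = Poly_Mapping.single 0 a"

definition var :: "'v \<Rightarrow> 'v cmpoly" where
  "var v = Poly_Mapping.single (Poly_Mapping.single v 1) 1"

definition mon_val :: "('v \<Rightarrow> 'b::comm_ring_1) \<Rightarrow> ('v \<Rightarrow>\<^sub>0 nat) \<Rightarrow> 'b" where
  "mon_val s m = (\<Prod>v\<in>Poly_Mapping.keys m. s v ^ Poly_Mapping.lookup m v)"

definition mp_eval :: "('v \<Rightarrow> complex) \<Rightarrow> 'v cmpoly \<Rightarrow> complex" where
  "mp_eval a p = (\<Sum>m\<in>Poly_Mapping.keys p. Poly_Mapping.lookup p m * mon_val a m)"

definition mp_subst :: "('v \<Rightarrow> 'w cmpoly) \<Rightarrow> 'v cmpoly \<Rightarrow> 'w cmpoly" where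
  "mp_subst s p = (\<Sum>m\<in>Poly_Mapping.keys p. const (Poly_Mapping.lookup p m) * mon_val s m)"

definition homogeneous :: "nat \<Rightarrow> 'v cmpoly \<Rightarrow> bool" where
  "homogeneous d p \<longleftrightarrow> (\<forall>m\<in>Poly_Mapping.keys p. mdeg m = d)"

definition polys_in :: "nat \<Rightarrow> cpoly set" where
  "polys_in k = {f. \<forall>m\<in>Poly_Mapping.keys f. Poly_Mapping.keys m \<subseteq> {..<k}}"

definition forms :: "nat \<Rightarrow> nat \<Rightarrow> cpoly set" where
  "forms d k = {f \<in> polys_in k. homogeneous d f}"

definition exponents :: "nat \<Rightarrow> nat \<Rightarrow> (nat \<Rightarrow>\<^sub>0 nat) set" where
  "exponents d k = {\<mu>. Poly_Mapping.keys \<mu> \<subseteq> {..<k} \<and> mdeg \<mu> = d}"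

definition poly_bounded :: "(nat \<Rightarrow> nat) \<Rightarrow> bool" where
  "poly_bounded a \<longleftrightarrow> (\<exists>p :: nat poly. \<forall>n. a n \<le> poly p n)"

definition p_family :: "(nat \<Rightarrow> cpoly) \<Rightarrow> bool" where
  "p_family f \<longleftrightarrow>
     (\<exists>k d. poly_bounded k \<and> poly_bounded d \<and>
        (\<forall>n. f n \<in> polys_in (k n) \<and> (\<forall>m\<in>Poly_Mapping.keys (f n). mdeg m \<le> d n)))"


section \<open>The action of the general linear group on polynomials\<close>

definition GL :: "nat \<Rightarrow> complex mat monoid" where
  "GL k = units_of (ring_mat TYPE(complex) k ())"

text \<open>\<open>(g \<cdot> f)(x) = f(g\<^sup>-\<^sup>1 x)\<close>; only meaningful for \<open>f\<close> in \<open>polys_in k\<close>.\<close>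

definition gl_act :: "nat \<Rightarrow> complex mat \<Rightarrow> cpoly \<Rightarrow> cpoly" where
  "gl_act k g f = mp_subst (\<lambda>i. \<Sum>j<k. const ((inv\<^bsub>GL k\<^esub> g) $$ (i, j)) * var j) f"

definition invariant_measure :: "(cpoly \<Rightarrow> nat) \<Rightarrow> bool" where
  "invariant_measure c \<longleftrightarrow>
     (\<forall>k. \<forall>f\<in>polys_in k. \<forall>g\<in>carrier (GL k). c (gl_act k g f) = c f)"


section \<open>Metapolynomials\<close>

text \<open>The variable \<open>c\<^sub>\<mu>\<close> is indexed by the exponent vector \<open>\<mu>\<close> itself.\<close>

type_synonym metapoly = "(nat \<Rightarrow>\<^sub>0 nat) cmpoly"

definition metapolys :: "nat \<Rightarrow> nat \<Rightarrow> nat \<Rightarrow> metapoly set" where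
  "metapolys \<delta> d k =
     {\<Delta>. homogeneous \<delta> \<Delta> \<and> (\<forall>m\<in>Poly_Mapping.keys \<Delta>. Poly_Mapping.keys m \<subseteq> exponents d k)}"

definition meta_eval :: "metapoly \<Rightarrow> cpoly \<Rightarrow> complex" where
  "meta_eval \<Delta> f = mp_eval (Poly_Mapping.lookup f) \<Delta>"

text \<open>
  The action is given by \<open>(g \<cdot> \<Delta>)(f) = \<Delta>(g\<^sup>-\<^sup>1 \<cdot> f)\<close>. As a substitution, \<open>c\<^sub>\<mu>\<close> is replaced by the
  linear form that reads off the coefficient of \<open>x\<^sup>\<mu>\<close> in \<open>g\<^sup>-\<^sup>1 \<cdot> (\<Sum>\<^sub>\<nu> c\<^sub>\<nu> x\<^sup>\<nu>)\<close>; the lemma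
  \<open>meta_eval_meta_act\<close> below is the defining equation.
\<close>

definition meta_act :: "nat \<Rightarrow> nat \<Rightarrow> complex mat \<Rightarrow> metapoly \<Rightarrow> metapoly" where
  "meta_act d k g \<Delta> =
     mp_subst (\<lambda>\<mu>. \<Sum>\<nu>\<in>exponents d k.
       const (Poly_Mapping.lookup (gl_act k (inv\<^bsub>GL k\<^esub> g) (Poly_Mapping.single \<nu> 1)) \<mu>) * var \<nu>) \<Delta>"

lemma mp_eval_superset:
  assumes "finite S" "Poly_Mapping.keys p \<subseteq> S"
  shows "mp_eval a p = (\<Sum>m\<in>S. Poly_Mapping.lookup p m * mon_val a m)"
  unfolding mp_eval_def using assms
  by (intro sum.mono_neutral_left) (auto simp: in_keys_iff)

lemma mp_eval_0 [simp]: "mp_eval a 0 = 0"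
  by (simp add: mp_eval_def)

lemma mp_eval_add: "mp_eval a (p + q) = mp_eval a p + mp_eval a q"
proof -
  let ?S = "Poly_Mapping.keys p \<union> Poly_Mapping.keys q"
  have "mp_eval a r = (\<Sum>m\<in>?S. Poly_Mapping.lookup r m * mon_val a m)"
    if "Poly_Mapping.keys r \<subseteq> ?S" for r
    using that by (intro mp_eval_superset) auto
  moreover have "Poly_Mapping.keys (p + q) \<subseteq> ?S" by (rule Poly_Mapping.keys_add)
  ultimately show ?thesis
    by (simp add: lookup_add distrib_right sum.distrib)
qed

lemma mp_eval_sum: "mp_eval a (sum f A) = (\<Sum>x\<in>A. mp_eval a (f x))"
  by (induction A rule: infinite_finite_induct) (auto simp: mp_eval_add)

lemma mp_eval_single: "mp_eval a (Poly_Mapping.single m b) = b * mon_val a m"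
  by (cases "b = 0") (auto simp: mp_eval_def)

lemma mon_val_superset:
  assumes "finite S" "Poly_Mapping.keys m \<subseteq> S"
  shows "mon_val s m = (\<Prod>v\<in>S. s v ^ Poly_Mapping.lookup m v)"
  unfolding mon_val_def using assms
  by (intro prod.mono_neutral_left) (auto simp: in_keys_iff)

lemma mon_val_add: "mon_val s (m + n) = mon_val s m * mon_val s n"
proof -
  let ?S = "Poly_Mapping.keys m \<union> Poly_Mapping.keys n"
  have "mon_val s r = (\<Prod>v\<in>?S. s v ^ Poly_Mapping.lookup r v)"
    if "Poly_Mapping.keys r \<subseteq> ?S" for r
    using that by (intro mon_val_superset) auto
  moreover have "Poly_Mapping.keys (m + n) \<subseteq> ?S" by (rule Poly_Mapping.keys_add)
  ultimately show ?thesis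
    by (simp add: lookup_add power_add prod.distrib)
qed

lemma poly_mapping_expand:
  fixes p :: "'v cmpoly"
  shows "p = (\<Sum>m\<in>Poly_Mapping.keys p. Poly_Mapping.single m (Poly_Mapping.lookup p m))"
proof (rule poly_mapping_eqI)
  fix k
  have "(\<Sum>m\<in>Poly_Mapping.keys p. Poly_Mapping.lookup (Poly_Mapping.single m (Poly_Mapping.lookup p m)) k)
      = (\<Sum>m\<in>Poly_Mapping.keys p. if m = k then Poly_Mapping.lookup p m else 0)"
    by (intro sum.cong) (auto simp: lookup_single)
  then show "Poly_Mapping.lookup p k = Poly_Mapping.lookup (\<Sum>m\<in>Poly_Mapping.keys p.
      Poly_Mapping.single m (Poly_Mapping.lookup p m)) k"
    by (simp add: lookup_sum in_keys_iff)
qed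

lemma mp_eval_mult: "mp_eval a (p * q) = mp_eval a p * mp_eval a q"
proof -
  have "p * q = (\<Sum>m\<in>Poly_Mapping.keys p. \<Sum>n\<in>Poly_Mapping.keys q.
     Poly_Mapping.single (m + n) (Poly_Mapping.lookup p m * Poly_Mapping.lookup q n))"
    by (subst poly_mapping_expand [of p], subst poly_mapping_expand [of q])
      (simp add: sum_product mult_single)
  then show ?thesis
    by (simp add: mp_eval_sum mp_eval_single mon_val_add mp_eval_def [of a p] mp_eval_def [of a q]
        sum_product mult_ac)
qed

lemma mp_eval_const [simp]: "mp_eval a (const b) = b"
  by (simp add: const_def mp_eval_single mon_val_def)

lemma mp_eval_1 [simp]: "mp_eval a 1 = 1"
  using mp_eval_const [of a 1] by (simp add: const_def)

lemma mp_eval_var [simp]: "mp_eval a (var v) = a v"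
  by (simp add: var_def mp_eval_single mon_val_def)

lemma mp_eval_power: "mp_eval a (p ^ n) = mp_eval a p ^ n"
  by (induction n) (auto simp: mp_eval_mult)

lemma mp_eval_prod: "mp_eval a (prod f A) = (\<Prod>x\<in>A. mp_eval a (f x))"
  by (induction A rule: infinite_finite_induct) (auto simp: mp_eval_mult)

lemma mp_eval_subst: "mp_eval a (mp_subst s p) = mp_eval (\<lambda>v. mp_eval a (s v)) p"
  by (simp add: mp_subst_def mp_eval_sum mp_eval_mult mon_val_def mp_eval_prod mp_eval_power
      mp_eval_def [of _ p])

lemma mp_subst_single: "mp_subst s (Poly_Mapping.single m b) = const b * mon_val s m"
  by (cases "b = 0") (auto simp: mp_subst_def const_def)

lemma lookup_const_mult: "Poly_Mapping.lookup (const b * p) m = b * Poly_Mapping.lookup p m"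
  unfolding const_def mult_map_scale_conv_mult [symmetric]
  by (simp add: Poly_Mapping.map.rep_eq when_def)

lemma finite_exponents: "finite (exponents d k)"
proof -
  have "Poly_Mapping.lookup ` exponents d k \<subseteq>
      {f. \<forall>i. (i \<in> {..<k} \<longrightarrow> f i \<in> {..d}) \<and> (i \<notin> {..<k} \<longrightarrow> f i = 0)}"
  proof (safe, goal_cases)
    case (1 f \<mu> i)
    then show ?case
      by (cases "i \<in> Poly_Mapping.keys \<mu>")
        (auto simp: exponents_def mdeg_def in_keys_iff intro!: member_le_sum)
  next
    case (2 f \<mu> i)
    then show ?case
      by (auto simp: exponents_def in_keys_iff subset_iff)
  qed
  then have "finite (Poly_Mapping.lookup ` exponents d k)"
    by (rule finite_subset) (rule finite_set_of_finite_funs; simp)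
  then show ?thesis
    by (rule finite_imageD) (simp add: inj_on_def poly_mapping_eqI)
qed

lemma meta_eval_meta_act:
  assumes "f \<in> forms d k"
  shows "meta_eval (meta_act d k g \<Delta>) f = meta_eval \<Delta> (gl_act k (inv\<^bsub>GL k\<^esub> g) f)"
proof -
  let ?h = "inv\<^bsub>GL k\<^esub> g"
  have keys: "Poly_Mapping.keys f \<subseteq> exponents d k"
    using assms by (auto simp: forms_def polys_in_def exponents_def homogeneous_def)
  have "(\<Sum>\<nu>\<in>exponents d k. Poly_Mapping.lookup (gl_act k ?h (Poly_Mapping.single \<nu> 1)) \<mu> *
          Poly_Mapping.lookup f \<nu>) = Poly_Mapping.lookup (gl_act k ?h f) \<mu>" for \<mu>
  proof -
    have "Poly_Mapping.lookup (gl_act k ?h f) \<mu> = (\<Sum>\<nu>\<in>Poly_Mapping.keys f.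
        Poly_Mapping.lookup (gl_act k ?h (Poly_Mapping.single \<nu> 1)) \<mu> * Poly_Mapping.lookup f \<nu>)"
      unfolding gl_act_def mp_subst_single
      unfolding mp_subst_def by (simp add: lookup_sum lookup_const_mult mult.commute)
    also have "\<dots> = (\<Sum>\<nu>\<in>exponents d k.
        Poly_Mapping.lookup (gl_act k ?h (Poly_Mapping.single \<nu> 1)) \<mu> * Poly_Mapping.lookup f \<nu>)"
      using keys by (intro sum.mono_neutral_left finite_exponents) (auto simp: in_keys_iff)
    finally show ?thesis ..
  qed
  then show ?thesis
    by (simp add: meta_eval_def meta_act_def mp_eval_subst mp_eval_sum mp_eval_mult)
qed


section \<open>Isotypic components\<close>

definition cscale :: "complex \<Rightarrow> 'v cmpoly \<Rightarrow> 'v cmpoly" where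
  "cscale a p = const a * p"

global_interpretation cmpoly: vector_space "cscale :: complex \<Rightarrow> 'v cmpoly \<Rightarrow> 'v cmpoly"
  by unfold_locales
    (auto simp: cscale_def const_def distrib_left distrib_right single_add mult_single
      mult.assoc [symmetric])

definition subrep :: "nat \<Rightarrow> nat \<Rightarrow> nat \<Rightarrow> metapoly set \<Rightarrow> bool" where
  "subrep \<delta> d k W \<longleftrightarrow>
     W \<subseteq> metapolys \<delta> d k \<and> cmpoly.subspace W \<and>
     (\<forall>g\<in>carrier (GL k). \<forall>\<Delta>\<in>W. meta_act d k g \<Delta> \<in> W)"

definition irreducible_subrep :: "nat \<Rightarrow> nat \<Rightarrow> nat \<Rightarrow> metapoly set \<Rightarrow> bool" where
  "irreducible_subrep \<delta> d k W \<longleftrightarrow>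
     subrep \<delta> d k W \<and> W \<noteq> {0} \<and> (\<forall>U. subrep \<delta> d k U \<and> U \<subseteq> W \<longrightarrow> U = {0} \<or> U = W)"

text \<open>Partitions of \<open>m\<close> with at most \<open>k\<close> parts, padded with zeros.\<close>

definition partitions :: "nat \<Rightarrow> nat \<Rightarrow> (nat \<Rightarrow> nat) set" where
  "partitions m k = {l. antimono l \<and> (\<forall>i\<ge>k. l i = 0) \<and> (\<Sum>i<k. l i) = m}"

definition highest_weight_vector ::
    "nat \<Rightarrow> nat \<Rightarrow> (nat \<Rightarrow> nat) \<Rightarrow> metapoly \<Rightarrow> bool" where
  "highest_weight_vector d k l \<Delta> \<longleftrightarrow>
     \<Delta> \<noteq> 0 \<and>
     (\<forall>g\<in>carrier (GL k). upper_triangular g \<longrightarrow>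
        meta_act d k g \<Delta> = cscale (\<Prod>i<k. g $$ (i, i) ^ l i) \<Delta>)"

definition isotypic_component ::
    "nat \<Rightarrow> nat \<Rightarrow> nat \<Rightarrow> (nat \<Rightarrow> nat) \<Rightarrow> metapoly set" where
  "isotypic_component \<delta> d k l =
     cmpoly.span (\<Union>{W. irreducible_subrep \<delta> d k W \<and> (\<exists>\<Delta>\<in>W. highest_weight_vector d k l \<Delta>)})"


section \<open>Algebraic circuits\<close>

text \<open>
  A non-input vertex records the scalar on and the source of each of its two incoming edges;
  the two edges may be parallel. The vertices are natural numbers, without any convention on
  their order.
\<close>

datatype gate =
    Input metapoly
  | Plus complex nat complex nat
  | Times complex nat complex nat

fun preds :: "gate \<Rightarrow> nat set" where
  "preds (Input p) = {}"
| "preds (Plus a u b v) = {u, v}"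
| "preds (Times a u b v) = {u, v}"

definition affine_linear :: "'v cmpoly \<Rightarrow> bool" where
  "affine_linear p \<longleftrightarrow> (\<forall>m\<in>Poly_Mapping.keys p. mdeg m \<le> 1)"

definition circuit_edges :: "nat set \<Rightarrow> (nat \<Rightarrow> gate) \<Rightarrow> (nat \<times> nat) set" where
  "circuit_edges V L = {(u, v). v \<in> V \<and> u \<in> preds (L v)}"

definition is_output :: "nat set \<Rightarrow> (nat \<Rightarrow> gate) \<Rightarrow> nat \<Rightarrow> bool" where
  "is_output V L w \<longleftrightarrow> w \<in> V \<and> (\<forall>v. (w, v) \<notin> circuit_edges V L)"

definition is_circuit :: "nat set \<Rightarrow> (nat \<Rightarrow> gate) \<Rightarrow> bool" where
  "is_circuit V L \<longleftrightarrow>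
     finite V \<and> (\<forall>v\<in>V. preds (L v) \<subseteq> V) \<and> acyclic (circuit_edges V L) \<and>
     (\<exists>!w. is_output V L w) \<and>
     (\<forall>v\<in>V. \<forall>p. L v = Input p \<longrightarrow> affine_linear p)"

fun gate_val :: "(nat \<Rightarrow> metapoly) \<Rightarrow> gate \<Rightarrow> metapoly" where
  "gate_val val (Input p) = p"
| "gate_val val (Plus a u b v) = cscale a (val u) + cscale b (val v)"
| "gate_val val (Times a u b v) = cscale (a * b) (val u * val v)"

text \<open>By acyclicity the gate equations determine \<open>val\<close> uniquely on \<open>V\<close>.\<close>

definition computes :: "nat set \<Rightarrow> (nat \<Rightarrow> gate) \<Rightarrow> metapoly \<Rightarrow> bool" where
  "computes V L \<Delta> \<longleftrightarrow>
     (\<exists>val. (\<forall>v\<in>V. val v = gate_val val (L v)) \<and> (\<exists>w. is_output V L w \<and> val w = \<Delta>))"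

definition cc :: "metapoly \<Rightarrow> nat" where
  "cc \<Delta> = (LEAST s. \<exists>V L. is_circuit V L \<and> computes V L \<Delta> \<and> card V = s)"


section \<open>Classes of sequences of metapolynomials\<close>

text \<open>
  A sequence carries its format: the triple \<open>(\<delta>, k, \<Delta>)\<close> stands for a sequence \<open>(\<Delta>\<^sub>n)\<close> in which
  \<open>\<Delta>\<^sub>n\<close> has format \<open>(\<delta>(n), n, k(n))\<close>.
\<close>

type_synonym metaseq = "(nat \<Rightarrow> nat) \<times> (nat \<Rightarrow> nat) \<times> (nat \<Rightarrow> metapoly)"

definition metaseqs :: "metaseq set" where
  "metaseqs = {(\<delta>, k, \<Delta>). \<forall>n. \<Delta> n \<in> metapolys (\<delta> n) n (k n)}"

definition isotypic_seqs :: "metaseq set" where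
  "isotypic_seqs =
     {(\<delta>, k, \<Delta>) \<in> metaseqs.
        \<forall>n. \<exists>l\<in>partitions (\<delta> n * n) (k n). \<Delta> n \<in> isotypic_component (\<delta> n) n (k n) l}"

definition X_set :: "(cpoly \<Rightarrow> nat) \<Rightarrow> nat \<Rightarrow> nat \<Rightarrow> cpoly set" where
  "X_set c d r = {f. homogeneous d f \<and> c f \<le> r}"

text \<open>
  The vanishing sequences \<open>I(\<C>)\<close> of the class \<open>\<C>\<close> of p-families on which \<open>c\<close> is polynomially
  bounded. They are defined by means of \<open>X_set\<close>, hence the argument \<open>c\<close> in place of \<open>\<C>\<close>.
\<close>

definition vanishing_seqs :: "(cpoly \<Rightarrow> nat) \<Rightarrow> metaseq set" where
  "vanishing_seqs c =
     {(\<delta>, k, \<Delta>) \<in> metaseqs.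
        \<forall>r. poly_bounded r \<longrightarrow>
          (\<forall>\<^sub>F n in sequentially. \<forall>f\<in>X_set c n (r n). meta_eval (\<Delta> n) f = 0)}"

definition metaVQP :: "metaseq set" where
  "metaVQP =
     {(\<delta>, k, \<Delta>) \<in> metaseqs.
        poly_bounded k \<and>
        (let N = (\<lambda>n. (k n + n - 1) choose n) in
          (\<exists>p :: nat poly. \<forall>n. \<delta> n \<le> poly p (N n)) \<and>
          (\<exists>p :: real poly. \<forall>n. real (cc (\<Delta> n)) \<le> 2 powr poly p (log 2 (real (N n)))))}"

definition eventually_zero :: "metaseq \<Rightarrow> bool" where
  "eventually_zero = (\<lambda>(\<delta>, k, \<Delta>). \<forall>\<^sub>F n in sequentially. \<Delta> n = 0)"

end

theory Submission
  imports Defs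
begin

text \<open>
  Let \<open>W\<close> be the span of the \<open>GL\<^sub>k\<close>-orbit of a metapolynomial \<open>\<Delta> \<noteq> 0\<close> of format \<open>(\<delta>, d, k)\<close>.
  By invariance of the measure, all of \<open>W\<close> vanishes on \<open>X\<^bsub>d,r\<^esub>\<close> as soon as \<open>\<Delta>\<close> does. As \<open>g \<cdot> \<Delta>\<close> is
  homogeneous of degree \<open>\<delta> d\<close> in the \<open>k\<^sup>2\<close> entries of \<open>g\<close>, the dimension of \<open>W\<close> is at most the
  number of monomials of degree \<open>\<delta> d\<close> in \<open>k\<^sup>2\<close> variables, which is quasipolynomial in
  \<open>N = (k + d - 1 choose d)\<close>. Every element of \<open>W\<close> is a linear combination of that many
  translates of \<open>\<Delta>\<close>, none of which is harder to compute than \<open>\<Delta>\<close>. So no projection has to be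
  computed: \<open>W\<close> contains an irreducible subrepresentation, which contains a highest weight
  vector, and that vector already lies in a single isotypic component.
\<close>

section \<open>Substitution and monomials\<close>

text \<open>Two obstacles shape the argument. First, \<open>X_set\<close> does not bound the number
  of variables, whereas a metapolynomial of format (\<delta>, d, k) reads only monomials in k of
  them. Invariance of \<open>c\<close> is therefore applied to \<open>g\<close> enlarged by an
  identity block, in as many variables as the given polynomial has. Second, the dimension bound
  (\<delta> d + 1)^(k^2) has to be expressed in log N alone. For k \<ge> 1 one has N \<ge> 2^min(k -
  1, d), so k - 1 or d is at most log N; in the latter case k is polynomial in log N as well, being
  polynomially bounded in d. That the action is a homogeneous polynomial in the matrix entries
  serves twice: it bounds the dimension, and it supplies the continuity by which an upper triangular
  matrix degenerates to its diagonal. Neither complete reducibility nor a classification of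
  irreducible representations enters: a nonzero subrepresentation of least dimension is irreducible,
  and a weight maximising a suitable linear functional is a highest weight.\<close>

lemma const_0 [simp]: "const 0 = 0"
  and const_1 [simp]: "const 1 = 1"
  and const_add: "const (a + b) = const a + const b"
  and const_mult: "const (a * b) = const a * const b"
  by (auto simp: const_def single_add mult_single)

lemma const_sum: "const (sum f A) = (\<Sum>x\<in>A. const (f x))"
  by (induction A rule: infinite_finite_induct) (auto simp: const_add)

lemma const_power: "const (a ^ n) = const a ^ n"
  by (induction n) (auto simp: const_mult)

lemma const_prod: "const (prod f A) = (\<Prod>x\<in>A. const (f x))"
  by (induction A rule: infinite_finite_induct) (auto simp: const_mult)

lemma lookup_cscale: "Poly_Mapping.lookup (cscale a p) m = a * Poly_Mapping.lookup p m"
  by (simp add: cscale_def lookup_const_mult)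

lemma cscale_mult: "cscale a p * cscale b q = cscale (a * b) (p * q)"
  by (simp add: cscale_def const_mult mult_ac)

lemma keys_cscale: "Poly_Mapping.keys (cscale a p) \<subseteq> Poly_Mapping.keys p"
  by (auto simp: in_keys_iff lookup_cscale)

lemma keys_sum_subset:
  assumes "\<And>x. x \<in> A \<Longrightarrow> Poly_Mapping.keys (f x) \<subseteq> S"
  shows "Poly_Mapping.keys (sum f A :: 'v \<Rightarrow>\<^sub>0 'b::comm_monoid_add) \<subseteq> S"
  using assms by (induction A rule: infinite_finite_induct) (auto dest: subsetD[OF Poly_Mapping.keys_add])

lemma mp_subst_superset:
  assumes "finite S" "Poly_Mapping.keys p \<subseteq> S"
  shows "mp_subst s p = (\<Sum>m\<in>S. const (Poly_Mapping.lookup p m) * mon_val s m)"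
  unfolding mp_subst_def using assms
  by (intro sum.mono_neutral_left) (auto simp: in_keys_iff)

lemma mp_subst_0 [simp]: "mp_subst s 0 = 0"
  by (simp add: mp_subst_def)

lemma mp_subst_add: "mp_subst s (p + q) = mp_subst s p + mp_subst s q"
proof -
  let ?S = "Poly_Mapping.keys p \<union> Poly_Mapping.keys q"
  have "mp_subst s r = (\<Sum>m\<in>?S. const (Poly_Mapping.lookup r m) * mon_val s m)"
    if "Poly_Mapping.keys r \<subseteq> ?S" for r
    using that by (intro mp_subst_superset) auto
  moreover have "Poly_Mapping.keys (p + q) \<subseteq> ?S" by (rule Poly_Mapping.keys_add)
  ultimately show ?thesis
    by (simp add: lookup_add const_add distrib_right sum.distrib)
qed

lemma mp_subst_sum: "mp_subst s (sum f A) = (\<Sum>x\<in>A. mp_subst s (f x))"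
  by (induction A rule: infinite_finite_induct) (auto simp: mp_subst_add)

lemma mp_subst_mult: "mp_subst s (p * q) = mp_subst s p * mp_subst s q"
proof -
  have "p * q = (\<Sum>m\<in>Poly_Mapping.keys p. \<Sum>n\<in>Poly_Mapping.keys q.
     Poly_Mapping.single (m + n) (Poly_Mapping.lookup p m * Poly_Mapping.lookup q n))"
    by (subst poly_mapping_expand [of p], subst poly_mapping_expand [of q])
      (simp add: sum_product mult_single)
  then show ?thesis
    by (simp add: mp_subst_sum mp_subst_single mon_val_add mp_subst_def [of s p]
        mp_subst_def [of s q] sum_product mult_ac const_mult)
qed

lemma mp_subst_const [simp]: "mp_subst s (const b) = const b"
  by (simp add: const_def mp_subst_single mon_val_def)

lemma mp_subst_1 [simp]: "mp_subst s 1 = 1"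
  using mp_subst_const [of s 1] by simp

lemma mp_subst_cscale: "mp_subst s (cscale b p) = cscale b (mp_subst s p)"
  by (simp add: cscale_def mp_subst_mult)

lemma mp_subst_var [simp]: "mp_subst s (var v) = s v"
  by (simp add: var_def mp_subst_single mon_val_def)

lemma mp_subst_power: "mp_subst s (p ^ n) = mp_subst s p ^ n"
  by (induction n) (auto simp: mp_subst_mult)

lemma mp_subst_prod: "mp_subst s (prod f A) = (\<Prod>x\<in>A. mp_subst s (f x))"
  by (induction A rule: infinite_finite_induct) (auto simp: mp_subst_mult)

lemma mp_subst_mon_val: "mp_subst s (mon_val t m) = mon_val (\<lambda>v. mp_subst s (t v)) m"
  by (simp add: mon_val_def mp_subst_prod mp_subst_power)

lemma mp_subst_subst: "mp_subst s (mp_subst t p) = mp_subst (\<lambda>v. mp_subst s (t v)) p"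
  by (simp add: mp_subst_def [of _ p] mp_subst_sum mp_subst_mult mp_subst_mon_val)

lemma mon_val_cong: "(\<And>v. v \<in> Poly_Mapping.keys m \<Longrightarrow> s v = t v) \<Longrightarrow> mon_val s m = mon_val t m"
  by (simp add: mon_val_def)

lemma mp_subst_cong:
  assumes "\<And>m v. m \<in> Poly_Mapping.keys p \<Longrightarrow> v \<in> Poly_Mapping.keys m \<Longrightarrow> s v = t v"
  shows "mp_subst s p = mp_subst t p"
  unfolding mp_subst_def by (intro sum.cong refl arg_cong2[where f="(*)"] mon_val_cong assms)

lemma mp_eval_cong:
  assumes "\<And>m v. m \<in> Poly_Mapping.keys p \<Longrightarrow> v \<in> Poly_Mapping.keys m \<Longrightarrow> s v = t v"
  shows "mp_eval s p = mp_eval t p"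
  unfolding mp_eval_def by (intro sum.cong refl arg_cong2[where f="(*)"] mon_val_cong assms)

lemma var_power: "var v ^ n = Poly_Mapping.single (Poly_Mapping.single v n) 1"
  by (induction n) (auto simp: var_def mult_single single_add [symmetric])

lemma mon_val_var: "mon_val var m = Poly_Mapping.single m 1"
proof -
  have "(\<Prod>v\<in>S. Poly_Mapping.single (f v) (1::complex)) = Poly_Mapping.single (sum f S) 1"
    for S :: "'a set" and f :: "'a \<Rightarrow> ('a \<Rightarrow>\<^sub>0 nat)"
    by (induction S rule: infinite_finite_induct) (auto simp: mult_single)
  moreover have "(\<Sum>v\<in>Poly_Mapping.keys m. Poly_Mapping.single v (Poly_Mapping.lookup m v)) = m"
    by (rule poly_mapping_eqI)
      (simp add: lookup_sum lookup_single when_def in_keys_iff)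
  ultimately show ?thesis
    by (simp add: mon_val_def var_power)
qed

lemma mon_val_scale_var:
  "mon_val (\<lambda>v. const (t v) * var v) m = Poly_Mapping.single m (mon_val t m)"
proof -
  have "mon_val (\<lambda>v. const (t v) * var v) m = const (mon_val t m) * mon_val var m"
    by (simp add: mon_val_def power_mult_distrib prod.distrib const_prod const_power)
  then show ?thesis
    by (simp add: mon_val_var const_def mult_single)
qed

section \<open>Degrees and supports of monomials\<close>

lemma mdeg_superset:
  assumes "finite S" "Poly_Mapping.keys m \<subseteq> S"
  shows "mdeg m = (\<Sum>v\<in>S. Poly_Mapping.lookup m v)"
  unfolding mdeg_def using assms
  by (intro sum.mono_neutral_left) (auto simp: in_keys_iff)

lemma mdeg_add: "mdeg (m + n) = mdeg m + mdeg n"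
proof -
  let ?S = "Poly_Mapping.keys m \<union> Poly_Mapping.keys n"
  have "mdeg r = (\<Sum>v\<in>?S. Poly_Mapping.lookup r v)"
    if "Poly_Mapping.keys r \<subseteq> ?S" for r
    using that by (intro mdeg_superset) auto
  moreover have "Poly_Mapping.keys (m + n) \<subseteq> ?S" by (rule Poly_Mapping.keys_add)
  ultimately show ?thesis
    by (simp add: lookup_add sum.distrib)
qed

lemma mdeg_0 [simp]: "mdeg 0 = 0"
  and mdeg_single [simp]: "mdeg (Poly_Mapping.single v n) = n"
  by (auto simp: mdeg_def)

text \<open>One notion for four uses: exponent vectors of forms, monomials in the
  \<open>c_\<mu>\<close>, monomials in matrix entries and, with \<open>S = UNIV\<close>, bare
  homogeneity. Degree and variable conditions become a single inclusion of
  \<open>keys\<close>.\<close>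

definition mons :: "'v set \<Rightarrow> nat \<Rightarrow> ('v \<Rightarrow>\<^sub>0 nat) set" where
  "mons S a = {m. Poly_Mapping.keys m \<subseteq> S \<and> mdeg m = a}"

lemma exponents_eq_mons: "exponents d k = mons {..<k} d"
  by (simp add: exponents_def mons_def)

lemma metapolys_eq_mons: "metapolys \<delta> d k = {p. Poly_Mapping.keys p \<subseteq> mons (exponents d k) \<delta>}"
  by (auto simp: metapolys_def mons_def homogeneous_def)

lemma mons_add: "m \<in> mons S a \<Longrightarrow> n \<in> mons S b \<Longrightarrow> m + n \<in> mons S (a + b)"
  using Poly_Mapping.keys_add[of m n] by (auto simp: mons_def mdeg_add)

lemma lookup_le_mdeg: "Poly_Mapping.lookup m v \<le> mdeg m"
  by (cases "v \<in> Poly_Mapping.keys m") (auto simp: mdeg_def in_keys_iff intro!: member_le_sum)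

text \<open>Restricting exponents to \<open>S\<close> embeds \<open>mons S a\<close> into the
  functions from \<open>S\<close> to \<open>{..a}\<close>. The crude count is enough, since
  \<open>card S\<close> will be k^2, a polylogarithmic quantity.\<close>

lemma
  assumes "finite S"
  shows finite_mons: "finite (mons S a)"
    and card_mons_le: "card (mons S a) \<le> (a + 1) ^ card S"
proof -
  let ?f = "\<lambda>m. restrict (Poly_Mapping.lookup m) S"
  have inj: "inj_on ?f (mons S a)"
  proof (rule inj_onI, rule poly_mapping_eqI)
    fix m n v assume mn: "m \<in> mons S a" "n \<in> mons S a" "?f m = ?f n"
    show "Poly_Mapping.lookup m v = Poly_Mapping.lookup n v"
    proof (cases "v \<in> S")
      case True
      then show ?thesis using fun_cong[OF mn(3), of v] by simp
    next
      case False
      then have "v \<notin> Poly_Mapping.keys m" "v \<notin> Poly_Mapping.keys n"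
        using mn by (auto simp: mons_def)
      then show ?thesis by (simp add: in_keys_iff)
    qed
  qed
  have sub: "?f ` mons S a \<subseteq> PiE S (\<lambda>_. {..a})"
    using lookup_le_mdeg by (fastforce simp: mons_def)
  have fin: "finite (PiE S (\<lambda>_. {..a}))"
    using assms by (intro finite_PiE) auto
  show "finite (mons S a)"
    using finite_subset[OF sub fin] inj by (rule finite_imageD)
  show "card (mons S a) \<le> (a + 1) ^ card S"
    using card_inj_on_le[OF inj sub fin] assms by (simp add: card_PiE)
qed

text \<open>Serves the case k \<le> 1, where N is at most 1 while n is arbitrary, so that
  \<open>(a + 1) ^ card S\<close> cannot be compared with N.\<close>

lemma card_mons_le_1:
  assumes "S \<subseteq> {v}"
  shows "card (mons S a) \<le> 1"
proof -
  have "mons S a \<subseteq> {Poly_Mapping.single v a}"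
  proof
    fix m assume m: "m \<in> mons S a"
    then have "mdeg m = (\<Sum>v\<in>{v}. Poly_Mapping.lookup m v)"
      using assms by (intro mdeg_superset) (auto simp: mons_def)
    then have "Poly_Mapping.lookup m v = a"
      using m by (simp add: mons_def)
    moreover have "Poly_Mapping.lookup m u = 0" if "u \<noteq> v" for u
    proof -
      have "u \<notin> Poly_Mapping.keys m" using that assms m by (auto simp: mons_def)
      then show ?thesis by (simp add: in_keys_iff)
    qed
    ultimately have "m = Poly_Mapping.single v a"
      by (intro poly_mapping_eqI) (auto simp: lookup_single when_def)
    then show "m \<in> {Poly_Mapping.single v a}" by simp
  qed
  then show ?thesis
    using card_mono[of "{Poly_Mapping.single v a}" "mons S a"] by simp
qed

lemma keys_mult_mons:
  fixes p q :: "'v cmpoly"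
  assumes "Poly_Mapping.keys p \<subseteq> mons S a" "Poly_Mapping.keys q \<subseteq> mons S b"
  shows "Poly_Mapping.keys (p * q) \<subseteq> mons S (a + b)"
  using assms keys_mult[of p q] mons_add by fastforce

lemma keys_const_mons: "Poly_Mapping.keys (const a) \<subseteq> mons S 0"
  by (auto simp: const_def mons_def split: if_splits)

lemma keys_power_mons:
  fixes p :: "'v cmpoly"
  assumes "Poly_Mapping.keys p \<subseteq> mons S a"
  shows "Poly_Mapping.keys (p ^ n) \<subseteq> mons S (n * a)"
proof (induction n)
  case 0
  then show ?case using keys_const_mons[of 1 S] by simp
next
  case (Suc n)
  then show ?case using keys_mult_mons[OF assms] by simp
qed

lemma keys_mon_val_mons:
  fixes s :: "'v \<Rightarrow> 'w cmpoly"
  assumes "\<And>v. v \<in> Poly_Mapping.keys m \<Longrightarrow> Poly_Mapping.keys (s v) \<subseteq> mons S 1"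
  shows "Poly_Mapping.keys (mon_val s m) \<subseteq> mons S (mdeg m)"
proof -
  have "Poly_Mapping.keys (\<Prod>v\<in>T. s v ^ Poly_Mapping.lookup m v)
      \<subseteq> mons S (\<Sum>v\<in>T. Poly_Mapping.lookup m v)"
    if "finite T" "T \<subseteq> Poly_Mapping.keys m" for T
    using that
  proof (induction T rule: finite_induct)
    case empty
    then show ?case using keys_const_mons[of 1 S] by simp
  next
    case (insert v T)
    then show ?case
      using keys_mult_mons[OF keys_power_mons[OF assms]] by simp
  qed
  then show ?thesis by (simp add: mon_val_def mdeg_def)
qed

lemma keys_mp_subst_mons:
  fixes s :: "'v \<Rightarrow> 'w cmpoly"
  assumes "\<And>v. v \<in> T \<Longrightarrow> Poly_Mapping.keys (s v) \<subseteq> mons S 1"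
    and "Poly_Mapping.keys p \<subseteq> mons T a"
  shows "Poly_Mapping.keys (mp_subst s p) \<subseteq> mons S a"
  unfolding mp_subst_def
proof (rule keys_sum_subset)
  fix m assume "m \<in> Poly_Mapping.keys p"
  then have m: "Poly_Mapping.keys m \<subseteq> T" "mdeg m = a"
    using assms(2) by (auto simp: mons_def)
  then have "Poly_Mapping.keys (mon_val s m) \<subseteq> mons S a"
    using keys_mon_val_mons[of m s S] assms(1) by auto
  then show "Poly_Mapping.keys (const (Poly_Mapping.lookup p m) * mon_val s m) \<subseteq> mons S a"
    using keys_cscale[of "Poly_Mapping.lookup p m" "mon_val s m"] by (auto simp: cscale_def)
qed

lemma keys_linear_form:
  assumes "\<And>x. x \<in> A \<Longrightarrow> f x \<in> S"
  shows "Poly_Mapping.keys (\<Sum>x\<in>A. const (a x) * var (f x)) \<subseteq> mons S 1"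
proof (rule keys_sum_subset)
  fix x assume "x \<in> A"
  then have "Poly_Mapping.keys (var (f x)) \<subseteq> mons S 1"
    using assms by (auto simp: var_def mons_def)
  then show "Poly_Mapping.keys (const (a x) * var (f x)) \<subseteq> mons S 1"
    using keys_cscale[of "a x" "var (f x)"] by (auto simp: cscale_def)
qed

section \<open>The action of matrices on metapolynomials\<close>

text \<open>Matrices are plain functions from here on, so that singular matrices and matrices
  depending on a parameter can be used freely. Only entries with indices below \<open>k\<close>
  matter.\<close>

definition lin_form :: "nat \<Rightarrow> (nat \<Rightarrow> nat \<Rightarrow> complex) \<Rightarrow> nat \<Rightarrow> cpoly" where
  "lin_form k A i = (\<Sum>j<k. const (A i j) * var j)"

text \<open>The coefficient of \<open>x^\<mu>\<close> in the generic form with coefficients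
  \<open>c_\<nu>\<close> after the linear substitution \<open>A\<close>, as a linear form in the
  \<open>c_\<nu>\<close>.\<close>

definition coeff_form ::
    "nat \<Rightarrow> nat \<Rightarrow> (nat \<Rightarrow> nat \<Rightarrow> complex) \<Rightarrow> (nat \<Rightarrow>\<^sub>0 nat) \<Rightarrow> metapoly" where
  "coeff_form d k A \<mu> = (\<Sum>\<nu>\<in>exponents d k.
     const (Poly_Mapping.lookup (mon_val (lin_form k A) \<nu>) \<mu>) * var \<nu>)"

definition mat_act :: "nat \<Rightarrow> nat \<Rightarrow> (nat \<Rightarrow> nat \<Rightarrow> complex) \<Rightarrow> metapoly \<Rightarrow> metapoly" where
  "mat_act d k A = mp_subst (coeff_form d k A)"

definition mmult ::
    "nat \<Rightarrow> (nat \<Rightarrow> nat \<Rightarrow> complex) \<Rightarrow> (nat \<Rightarrow> nat \<Rightarrow> complex) \<Rightarrow> nat \<Rightarrow> nat \<Rightarrow> complex" where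
  "mmult k A B i j = (\<Sum>l<k. A i l * B l j)"

lemma group_GL: "group (GL k)"
  unfolding GL_def using ring_mat[of k "()", where 'a=complex]
  by (intro monoid.units_group) (simp add: ring_def)

lemma GL_iff: "g \<in> carrier (GL k) \<longleftrightarrow>
   g \<in> carrier_mat k k \<and> (\<exists>h\<in>carrier_mat k k. h * g = 1\<^sub>m k \<and> g * h = 1\<^sub>m k)"
  by (simp add: GL_def units_of_carrier Units_def ring_mat_def)

lemma GL_mult: "g \<otimes>\<^bsub>GL k\<^esub> h = g * h"
  by (simp add: GL_def units_of_mult ring_mat_def)

lemma GL_one: "\<one>\<^bsub>GL k\<^esub> = 1\<^sub>m k"
  by (simp add: GL_def units_of_one ring_mat_def)

lemma keys_lin_form: "Poly_Mapping.keys (lin_form k A i) \<subseteq> mons {..<k} 1"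
  unfolding lin_form_def by (rule keys_linear_form) auto

lemma keys_mon_val_lin_form:
  "\<nu> \<in> exponents d k \<Longrightarrow> Poly_Mapping.keys (mon_val (lin_form k A) \<nu>) \<subseteq> exponents d k"
  using keys_mon_val_mons[of \<nu> "lin_form k A" "{..<k}"] keys_lin_form
  by (simp add: exponents_eq_mons mons_def)

lemma keys_coeff_form: "Poly_Mapping.keys (coeff_form d k A \<mu>) \<subseteq> mons (exponents d k) 1"
  unfolding coeff_form_def by (rule keys_linear_form) auto

lemma mat_act_metapolys:
  "\<Delta> \<in> metapolys \<delta> d k \<Longrightarrow> mat_act d k A \<Delta> \<in> metapolys \<delta> d k"
  using keys_mp_subst_mons[where s = "coeff_form d k A", OF keys_coeff_form, of \<Delta>]
  by (simp add: metapolys_eq_mons mat_act_def)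

text \<open>The inverse in the action on metapolynomials cancels the one in the action on
  polynomials. So a translate depends polynomially on the entries of \<open>g\<close>, without a
  determinant in a denominator.\<close>

lemma meta_act_eq_mat_act:
  assumes "g \<in> carrier (GL k)"
  shows "meta_act d k g = mat_act d k (\<lambda>i j. g $$ (i, j))"
proof -
  have "inv\<^bsub>GL k\<^esub> (inv\<^bsub>GL k\<^esub> g) = g"
    using group.inv_inv[OF group_GL assms] .
  then show ?thesis
    by (intro ext) (simp add: meta_act_def mat_act_def gl_act_def mp_subst_single coeff_form_def[abs_def]
        lin_form_def[abs_def])
qed

lemma lin_form_cong:
  "(\<And>j. j < k \<Longrightarrow> A i j = B i j) \<Longrightarrow> lin_form k A i = lin_form k B i"
  by (simp add: lin_form_def)

lemma mat_act_cong:
  assumes "\<And>i j. i < k \<Longrightarrow> j < k \<Longrightarrow> A i j = B i j"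
  shows "mat_act d k A = mat_act d k B"
proof -
  have "mon_val (lin_form k A) \<nu> = mon_val (lin_form k B) \<nu>" if "\<nu> \<in> exponents d k" for \<nu>
    using that assms by (intro mon_val_cong lin_form_cong) (auto simp: exponents_def)
  then show ?thesis
    by (simp add: mat_act_def coeff_form_def[abs_def])
qed

lemma mat_act_add: "mat_act d k A (p + q) = mat_act d k A p + mat_act d k A q"
  by (simp add: mat_act_def mp_subst_add)

lemma mat_act_cscale: "mat_act d k A (cscale a p) = cscale a (mat_act d k A p)"
  by (simp add: mat_act_def mp_subst_cscale)

lemma mat_act_0 [simp]: "mat_act d k A 0 = 0"
  by (simp add: mat_act_def)

lemma mp_subst_lin_form: "mp_subst (lin_form k B) (lin_form k A i) = lin_form k (mmult k A B) i"
proof -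
  have "mp_subst (lin_form k B) (lin_form k A i)
      = (\<Sum>l<k. \<Sum>j<k. const (A i l * B l j) * var j)"
    unfolding lin_form_def[of k A]
    by (simp add: mp_subst_sum mp_subst_mult lin_form_def sum_distrib_left const_mult mult_ac)
  also have "\<dots> = (\<Sum>j<k. \<Sum>l<k. const (A i l * B l j) * var j)"
    by (rule sum.swap)
  also have "\<dots> = lin_form k (mmult k A B) i"
    by (simp add: lin_form_def mmult_def const_sum sum_distrib_right)
  finally show ?thesis .
qed

text \<open>Substitution into polynomials is a right action; passing to coefficients reverses the
  order once more and gives a left action. The fact \<open>lookup\<close> is the functoriality of
  the d-th symmetric power.\<close>

lemma mat_act_mat_act:
  "mat_act d k A (mat_act d k B \<Delta>) = mat_act d k (mmult k A B) \<Delta>"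
proof -
  have lookup: "Poly_Mapping.lookup (mon_val (lin_form k (mmult k A B)) \<kappa>) \<mu>
      = (\<Sum>\<nu>\<in>exponents d k. Poly_Mapping.lookup (mon_val (lin_form k A) \<kappa>) \<nu> *
          Poly_Mapping.lookup (mon_val (lin_form k B) \<nu>) \<mu>)"
    if "\<kappa> \<in> exponents d k" for \<kappa> \<mu>
  proof -
    have "mon_val (lin_form k (mmult k A B)) \<kappa> = mp_subst (lin_form k B) (mon_val (lin_form k A) \<kappa>)"
      by (simp add: mp_subst_mon_val mp_subst_lin_form)
    also have "\<dots> = (\<Sum>\<nu>\<in>exponents d k.
        const (Poly_Mapping.lookup (mon_val (lin_form k A) \<kappa>) \<nu>) * mon_val (lin_form k B) \<nu>)"
      using keys_mon_val_lin_form[OF that] by (intro mp_subst_superset finite_exponents)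
    finally show ?thesis by (simp add: lookup_sum lookup_const_mult)
  qed
  have "mp_subst (coeff_form d k A) (coeff_form d k B \<mu>) = coeff_form d k (mmult k A B) \<mu>" for \<mu>
  proof -
    have "mp_subst (coeff_form d k A) (coeff_form d k B \<mu>) =
       (\<Sum>\<nu>\<in>exponents d k. \<Sum>\<kappa>\<in>exponents d k.
          const (Poly_Mapping.lookup (mon_val (lin_form k A) \<kappa>) \<nu> *
            Poly_Mapping.lookup (mon_val (lin_form k B) \<nu>) \<mu>) * var \<kappa>)"
      unfolding coeff_form_def[of d k B]
      by (simp add: mp_subst_sum mp_subst_mult coeff_form_def sum_distrib_left const_mult mult_ac)
    also have "\<dots> = (\<Sum>\<kappa>\<in>exponents d k. \<Sum>\<nu>\<in>exponents d k.
          const (Poly_Mapping.lookup (mon_val (lin_form k A) \<kappa>) \<nu> *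
            Poly_Mapping.lookup (mon_val (lin_form k B) \<nu>) \<mu>) * var \<kappa>)"
      by (rule sum.swap)
    also have "\<dots> = coeff_form d k (mmult k A B) \<mu>"
      by (simp add: coeff_form_def lookup const_sum sum_distrib_right)
    finally show ?thesis .
  qed
  then show ?thesis
    by (simp add: mat_act_def mp_subst_subst)
qed

section \<open>Diagonal matrices and weights of monomials\<close>

definition diag :: "(nat \<Rightarrow> complex) \<Rightarrow> nat \<Rightarrow> nat \<Rightarrow> complex" where
  "diag t i j = (if i = j then t i else 0)"

lemma lin_form_diag: "i < k \<Longrightarrow> lin_form k (diag t) i = const (t i) * var i"
  unfolding lin_form_def diag_def
  by (subst sum.remove[of _ i]) (auto intro!: sum.neutral)

lemma coeff_form_diag:
  assumes "\<mu> \<in> exponents d k"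
  shows "coeff_form d k (diag t) \<mu> = const (mon_val t \<mu>) * var \<mu>"
proof -
  have "mon_val (lin_form k (diag t)) \<nu> = Poly_Mapping.single \<nu> (mon_val t \<nu>)"
    if "\<nu> \<in> exponents d k" for \<nu>
    unfolding mon_val_scale_var[symmetric]
    using that by (intro mon_val_cong lin_form_diag) (auto simp: exponents_def)
  then show ?thesis
    unfolding coeff_form_def using assms finite_exponents[of d k]
    by (subst sum.remove[of _ \<mu>]) (auto intro!: sum.neutral simp: lookup_single when_def)
qed

text \<open>The exponents of the character by which diagonal matrices act on the monomial
  \<open>m\<close>, where \<open>c_\<mu>\<close> has weight \<open>\<mu>\<close>.\<close>

definition weight :: "((nat \<Rightarrow>\<^sub>0 nat) \<Rightarrow>\<^sub>0 nat) \<Rightarrow> nat \<Rightarrow> nat" where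
  "weight m i = (\<Sum>\<mu>\<in>Poly_Mapping.keys m. Poly_Mapping.lookup m \<mu> * Poly_Mapping.lookup \<mu> i)"

lemma mon_val_mon_val:
  assumes "Poly_Mapping.keys m \<subseteq> exponents d k"
  shows "mon_val (mon_val t) m = (\<Prod>i<k. t i ^ weight m i)"
proof -
  have "mon_val (mon_val t) m
      = (\<Prod>\<mu>\<in>Poly_Mapping.keys m. \<Prod>i<k. t i ^ (Poly_Mapping.lookup m \<mu> * Poly_Mapping.lookup \<mu> i))"
    unfolding mon_val_def[of "mon_val t"]
  proof (rule prod.cong[OF refl])
    fix \<mu> assume "\<mu> \<in> Poly_Mapping.keys m"
    then have "mon_val t \<mu> = (\<Prod>i<k. t i ^ Poly_Mapping.lookup \<mu> i)"
      using assms by (intro mon_val_superset) (auto simp: exponents_def)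
    then show "mon_val t \<mu> ^ Poly_Mapping.lookup m \<mu>
        = (\<Prod>i<k. t i ^ (Poly_Mapping.lookup m \<mu> * Poly_Mapping.lookup \<mu> i))"
      by (simp add: prod_power_distrib power_mult[symmetric] mult.commute)
  qed
  also have "\<dots> = (\<Prod>i<k. \<Prod>\<mu>\<in>Poly_Mapping.keys m.
      t i ^ (Poly_Mapping.lookup m \<mu> * Poly_Mapping.lookup \<mu> i))"
    by (rule prod.swap)
  also have "\<dots> = (\<Prod>i<k. t i ^ weight m i)"
    by (simp add: weight_def power_sum)
  finally show ?thesis .
qed

text \<open>A diagonal matrix only rescales each \<open>c_\<mu>\<close>, so the monomials are
  simultaneous eigenvectors of the torus.\<close>

lemma lookup_mat_act_diag:
  assumes "\<Delta> \<in> metapolys \<delta> d k"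
  shows "Poly_Mapping.lookup (mat_act d k (diag t) \<Delta>) m
    = (\<Prod>i<k. t i ^ weight m i) * Poly_Mapping.lookup \<Delta> m"
proof -
  have "mat_act d k (diag t) \<Delta> = mp_subst (\<lambda>\<mu>. const (mon_val t \<mu>) * var \<mu>) \<Delta>"
    unfolding mat_act_def using assms
    by (intro mp_subst_cong coeff_form_diag) (auto simp: metapolys_def)
  then have "Poly_Mapping.lookup (mat_act d k (diag t) \<Delta>) m
    = (\<Sum>m'\<in>Poly_Mapping.keys \<Delta>. if m' = m then Poly_Mapping.lookup \<Delta> m' * mon_val (mon_val t) m' else 0)"
    by (simp add: mp_subst_def mon_val_scale_var lookup_sum lookup_const_mult lookup_single when_def
        if_distrib cong: if_cong)
  also have "\<dots> = (\<Prod>i<k. t i ^ weight m i) * Poly_Mapping.lookup \<Delta> m"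
    using assms by (auto simp: in_keys_iff metapolys_def intro!: mon_val_mon_val[of m d k])
  finally show ?thesis .
qed

lemma sum_weight:
  assumes "m \<in> mons (exponents d k) \<delta>"
  shows "(\<Sum>i<k. weight m i) = \<delta> * d"
proof -
  have "(\<Sum>i<k. weight m i) = (\<Sum>\<mu>\<in>Poly_Mapping.keys m. Poly_Mapping.lookup m \<mu> * (\<Sum>i<k. Poly_Mapping.lookup \<mu> i))"
    unfolding weight_def sum_distrib_left by (rule sum.swap)
  also have "\<dots> = (\<Sum>\<mu>\<in>Poly_Mapping.keys m. Poly_Mapping.lookup m \<mu> * d)"
    using assms by (intro sum.cong refl)
      (auto simp: mons_def exponents_def mdeg_superset[of "{..<k}", symmetric])
  also have "\<dots> = \<delta> * d"
    using assms by (simp add: mons_def mdeg_def sum_distrib_right[symmetric])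
  finally show ?thesis .
qed

lemma weight_eq_0:
  assumes "m \<in> mons (exponents d k) \<delta>" "i \<ge> k"
  shows "weight m i = 0"
proof -
  have "Poly_Mapping.lookup \<mu> i = 0" if "\<mu> \<in> Poly_Mapping.keys m" for \<mu>
  proof -
    have "i \<notin> Poly_Mapping.keys \<mu>"
      using assms that by (fastforce simp: mons_def exponents_def)
    then show ?thesis by (simp add: in_keys_iff)
  qed
  then show ?thesis by (simp add: weight_def)
qed

lemma mat_act_one:
  assumes "\<Delta> \<in> metapolys \<delta> d k"
  shows "mat_act d k (diag (\<lambda>_. 1)) \<Delta> = \<Delta>"
  using lookup_mat_act_diag[OF assms] by (intro poly_mapping_eqI) simp

section \<open>Polynomial dependence on the matrix entries\<close>

text \<open>A vector-valued form of degree \<open>D\<close> in the k^2 entries of \<open>A\<close>.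
  Writing it with coefficient vectors \<open>c \<alpha>\<close> that do not depend on
  \<open>A\<close> shows at once that all values lie in the span of finitely many vectors and that
  every coefficient of \<open>F A\<close> is continuous in the entries.\<close>

definition poly_dependent ::
    "nat \<Rightarrow> nat \<Rightarrow> ((nat \<Rightarrow> nat \<Rightarrow> complex) \<Rightarrow> 'v cmpoly) \<Rightarrow> bool" where
  "poly_dependent k D F \<longleftrightarrow> (\<exists>c. \<forall>A. F A =
     (\<Sum>\<alpha>\<in>mons ({..<k} \<times> {..<k}) D. cscale (mon_val (\<lambda>(i, j). A i j) \<alpha>) (c \<alpha>)))"

lemma poly_dependent_0: "poly_dependent k D (\<lambda>_. 0)"
  unfolding poly_dependent_def by (rule exI[of _ "\<lambda>_. 0"]) simp

lemma poly_dependent_add: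
  assumes "poly_dependent k D F" "poly_dependent k D G"
  shows "poly_dependent k D (\<lambda>A. F A + G A)"
proof -
  from assms obtain c c' where
    "\<forall>A. F A = (\<Sum>\<alpha>\<in>mons ({..<k} \<times> {..<k}) D. cscale (mon_val (\<lambda>(i, j). A i j) \<alpha>) (c \<alpha>))"
    "\<forall>A. G A = (\<Sum>\<alpha>\<in>mons ({..<k} \<times> {..<k}) D. cscale (mon_val (\<lambda>(i, j). A i j) \<alpha>) (c' \<alpha>))"
    unfolding poly_dependent_def by blast
  then show ?thesis
    unfolding poly_dependent_def
    by (intro exI[of _ "\<lambda>\<alpha>. c \<alpha> + c' \<alpha>"]) (simp add: sum.distrib cmpoly.scale_right_distrib)
qed

lemma poly_dependent_sum:
  "(\<And>x. x \<in> S \<Longrightarrow> poly_dependent k D (\<lambda>A. F A x)) \<Longrightarrow> poly_dependent k D (\<lambda>A. \<Sum>x\<in>S. F A x)"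
  by (induction S rule: infinite_finite_induct) (auto simp: poly_dependent_0 poly_dependent_add)

lemma mons_0: "mons S 0 = {0}"
proof -
  have "m = 0" if "mdeg m = 0" for m :: "'a \<Rightarrow>\<^sub>0 nat"
    using that lookup_le_mdeg[of m] by (intro poly_mapping_eqI) simp
  then show ?thesis by (auto simp: mons_def)
qed

lemma poly_dependent_const: "poly_dependent k 0 (\<lambda>_. p)"
  unfolding poly_dependent_def by (rule exI[of _ "\<lambda>_. p"]) (simp add: mons_0 mon_val_def)

lemma poly_dependent_entry:
  assumes "i < k" "j < k"
  shows "poly_dependent k 1 (\<lambda>A. const (A i j) * p)"
proof -
  let ?\<alpha> = "Poly_Mapping.single (i, j) (1::nat)"
  have "?\<alpha> \<in> mons ({..<k} \<times> {..<k}) 1"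
    using assms by (auto simp: mons_def)
  moreover have "mon_val (\<lambda>(i, j). A i j) ?\<alpha> = A i j" for A :: "nat \<Rightarrow> nat \<Rightarrow> complex"
    by (simp add: mon_val_def)
  ultimately have "const (A i j) * p = (\<Sum>\<alpha>\<in>mons ({..<k} \<times> {..<k}) 1.
      cscale (mon_val (\<lambda>(i, j). A i j) \<alpha>) (if \<alpha> = ?\<alpha> then p else 0))" for A
    by (subst sum.remove[of _ ?\<alpha>]) (auto simp: finite_mons cscale_def intro!: sum.neutral)
  then show ?thesis
    unfolding poly_dependent_def by (intro exI[of _ "\<lambda>\<alpha>. if \<alpha> = ?\<alpha> then p else 0"] allI)
qed

lemma poly_dependent_mult:
  assumes "poly_dependent k D F" "poly_dependent k E G"
  shows "poly_dependent k (D + E) (\<lambda>A. F A * G A)"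
proof -
  let ?M = "mons ({..<k} \<times> {..<k})"
  from assms(1) obtain c where
    c: "\<And>A. F A = (\<Sum>\<alpha>\<in>?M D. cscale (mon_val (\<lambda>(i, j). A i j) \<alpha>) (c \<alpha>))"
    unfolding poly_dependent_def by metis
  from assms(2) obtain c' where
    c': "\<And>A. G A = (\<Sum>\<alpha>\<in>?M E. cscale (mon_val (\<lambda>(i, j). A i j) \<alpha>) (c' \<alpha>))"
    unfolding poly_dependent_def by metis
  define b where "b \<gamma> = (\<Sum>\<alpha>\<beta>\<in>{\<alpha>\<beta>\<in>?M D \<times> ?M E. fst \<alpha>\<beta> + snd \<alpha>\<beta> = \<gamma>}. c (fst \<alpha>\<beta>) * c' (snd \<alpha>\<beta>))" for \<gamma>
  have fin: "finite (?M D \<times> ?M E)" "finite (?M (D + E))"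
    by (auto intro!: finite_mons)
  have "F A * G A = (\<Sum>\<gamma>\<in>?M (D + E). cscale (mon_val (\<lambda>(i, j). A i j) \<gamma>) (b \<gamma>))" for A
  proof -
    let ?v = "mon_val (\<lambda>(i, j). A i j)"
    have "F A * G A = (\<Sum>\<alpha>\<beta>\<in>?M D \<times> ?M E.
        cscale (?v (fst \<alpha>\<beta> + snd \<alpha>\<beta>)) (c (fst \<alpha>\<beta>) * c' (snd \<alpha>\<beta>)))"
      by (simp add: c c' sum_product sum.cartesian_product mon_val_add cscale_mult case_prod_beta)
    also have "\<dots> = (\<Sum>\<gamma>\<in>?M (D + E). \<Sum>\<alpha>\<beta>\<in>{\<alpha>\<beta>\<in>?M D \<times> ?M E. fst \<alpha>\<beta> + snd \<alpha>\<beta> = \<gamma>}.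
        cscale (?v (fst \<alpha>\<beta> + snd \<alpha>\<beta>)) (c (fst \<alpha>\<beta>) * c' (snd \<alpha>\<beta>)))"
      using fin by (intro sum.group[symmetric]) (auto intro: mons_add)
    also have "\<dots> = (\<Sum>\<gamma>\<in>?M (D + E). cscale (?v \<gamma>) (b \<gamma>))"
      unfolding b_def cmpoly.scale_sum_right by (intro sum.cong refl) auto
    finally show ?thesis .
  qed
  then show ?thesis
    unfolding poly_dependent_def by blast
qed

lemma poly_dependent_power:
  assumes "poly_dependent k D F"
  shows "poly_dependent k (n * D) (\<lambda>A. F A ^ n)"
  by (induction n) (auto intro: poly_dependent_const poly_dependent_mult[OF assms])

lemma poly_dependent_mon_val:
  assumes "\<And>v. v \<in> Poly_Mapping.keys m \<Longrightarrow> poly_dependent k D (\<lambda>A. s A v)"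
  shows "poly_dependent k (mdeg m * D) (\<lambda>A. mon_val (s A) m)"
proof -
  have "poly_dependent k (\<Sum>v\<in>T. Poly_Mapping.lookup m v * D) (\<lambda>A. \<Prod>v\<in>T. s A v ^ Poly_Mapping.lookup m v)"
    if "finite T" "T \<subseteq> Poly_Mapping.keys m" for T
    using that
    by (induction T rule: finite_induct)
      (auto intro!: poly_dependent_const poly_dependent_mult poly_dependent_power assms)
  then show ?thesis by (simp add: mon_val_def mdeg_def sum_distrib_right)
qed

lemma poly_dependent_lookup:
  assumes "poly_dependent k D F"
  shows "poly_dependent k D (\<lambda>A. const (Poly_Mapping.lookup (F A) m) * p)"
proof -
  from assms obtain c where
    "\<And>A. F A = (\<Sum>\<alpha>\<in>mons ({..<k} \<times> {..<k}) D. cscale (mon_val (\<lambda>(i, j). A i j) \<alpha>) (c \<alpha>))"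
    unfolding poly_dependent_def by metis
  then show ?thesis
    unfolding poly_dependent_def
    by (intro exI[of _ "\<lambda>\<alpha>. const (Poly_Mapping.lookup (c \<alpha>) m) * p"])
      (simp add: lookup_sum lookup_const_mult const_sum const_mult sum_distrib_right cscale_def mult.assoc)
qed

lemma poly_dependent_mat_act:
  assumes "\<Delta> \<in> metapolys \<delta> d k"
  shows "poly_dependent k (\<delta> * d) (\<lambda>A. mat_act d k A \<Delta>)"
proof -
  have lin: "poly_dependent k 1 (\<lambda>A. lin_form k A i)" if "i < k" for i
    unfolding lin_form_def using that by (intro poly_dependent_sum poly_dependent_entry) auto
  have mon: "poly_dependent k d (\<lambda>A. mon_val (lin_form k A) \<nu>)" if "\<nu> \<in> exponents d k" for \<nu>
    using that poly_dependent_mon_val[of \<nu> k 1 "lin_form k"] lin by (auto simp: exponents_def)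
  have coeff: "poly_dependent k d (\<lambda>A. coeff_form d k A \<mu>)" for \<mu>
    unfolding coeff_form_def by (intro poly_dependent_sum poly_dependent_lookup mon)
  \<comment> \<open>The summand 0 is the degree of the scalar coefficient; the product of \<delta>
    coefficient forms, each of degree d, accounts for the rest.\<close>
  have "poly_dependent k (0 + \<delta> * d)
      (\<lambda>A. const (Poly_Mapping.lookup \<Delta> m) * mon_val (coeff_form d k A) m)"
    if "m \<in> Poly_Mapping.keys \<Delta>" for m
  proof -
    have "mdeg m = \<delta>"
      using assms that by (auto simp: metapolys_def homogeneous_def)
    then show ?thesis
      using poly_dependent_mult[OF poly_dependent_const,
          OF poly_dependent_mon_val[where s = "coeff_form d k" and m = m, OF coeff]] by simp
  qed
  then show ?thesis
    unfolding mat_act_def mp_subst_def by (auto intro!: poly_dependent_sum)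
qed

section \<open>Circuits\<close>

definition has_circuit :: "nat \<Rightarrow> metapoly \<Rightarrow> bool" where
  "has_circuit s \<Delta> \<longleftrightarrow> (\<exists>V L. is_circuit V L \<and> computes V L \<Delta> \<and> card V = s)"

lemma cc_le: "has_circuit s \<Delta> \<Longrightarrow> cc \<Delta> \<le> s"
  unfolding cc_def has_circuit_def by (rule Least_le)

lemma has_circuit_cc: "has_circuit s \<Delta> \<Longrightarrow> has_circuit (cc \<Delta>) \<Delta>"
  unfolding cc_def has_circuit_def by (rule LeastI)

lemma has_circuit_input:
  assumes "affine_linear p"
  shows "has_circuit 1 p"
proof -
  have "circuit_edges {0} (\<lambda>_. Input p) = {}"
    by (auto simp: circuit_edges_def)
  then have "is_circuit {0} (\<lambda>_. Input p)" "computes {0} (\<lambda>_. Input p) p"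
    using assms by (auto simp: is_circuit_def computes_def is_output_def acyclic_def intro!: exI[of _ "\<lambda>_. p"])
  then show ?thesis
    unfolding has_circuit_def by (intro exI[of _ "{0}"] exI[of _ "\<lambda>_. Input p"]) auto
qed

fun subst_gate :: "((nat \<Rightarrow>\<^sub>0 nat) \<Rightarrow> metapoly) \<Rightarrow> gate \<Rightarrow> gate" where
  "subst_gate s (Input p) = Input (mp_subst s p)"
| "subst_gate s (Plus a u b v) = Plus a u b v"
| "subst_gate s (Times a u b v) = Times a u b v"

lemma preds_subst_gate [simp]: "preds (subst_gate s g) = preds g"
  by (cases g) auto

lemma gate_val_subst_gate:
  "gate_val (\<lambda>v. mp_subst s (val v)) (subst_gate s g) = mp_subst s (gate_val val g)"
  by (cases g) (auto simp: mp_subst_add mp_subst_cscale mp_subst_mult)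

text \<open>A substitution is a ring homomorphism fixing the constants, so it commutes with the
  gates and changes only input labels. As inputs may be arbitrary affine linear forms, a linear
  change of coordinates costs nothing.\<close>

lemma has_circuit_subst:
  assumes "has_circuit n \<Delta>" and s: "\<And>p. affine_linear p \<Longrightarrow> affine_linear (mp_subst s p)"
  shows "has_circuit n (mp_subst s \<Delta>)"
proof -
  obtain V L where VL: "is_circuit V L" "computes V L \<Delta>" "card V = n"
    using assms(1) unfolding has_circuit_def by blast
  let ?L = "\<lambda>v. subst_gate s (L v)"
  have edges: "circuit_edges V ?L = circuit_edges V L"
    by (simp add: circuit_edges_def)
  then have out: "is_output V ?L = is_output V L"
    by (simp add: is_output_def fun_eq_iff)
  have "affine_linear p" if "v \<in> V" "?L v = Input p" for v p
    using that VL(1) s by (cases "L v") (auto simp: is_circuit_def)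
  then have "is_circuit V ?L"
    using VL(1) by (simp add: is_circuit_def edges out)
  moreover obtain val w where val: "\<forall>v\<in>V. val v = gate_val val (L v)" "is_output V L w" "val w = \<Delta>"
    using VL(2) unfolding computes_def by blast
  then have "computes V ?L (mp_subst s \<Delta>)"
    unfolding computes_def
    by (intro exI[of _ "\<lambda>v. mp_subst s (val v)"]) (auto simp: out gate_val_subst_gate)
  ultimately show ?thesis
    unfolding has_circuit_def using VL(3) by blast
qed

lemma affine_linear_subst:
  assumes "\<And>v. Poly_Mapping.keys (s v) \<subseteq> mons UNIV 1" "affine_linear p"
  shows "affine_linear (mp_subst s p)"
proof -
  have "Poly_Mapping.keys (mp_subst s p) \<subseteq> {m. mdeg m \<le> 1}"
    unfolding mp_subst_def
  proof (rule keys_sum_subset)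
    fix m assume "m \<in> Poly_Mapping.keys p"
    then have "mdeg m \<le> 1" using assms(2) by (auto simp: affine_linear_def)
    then have "Poly_Mapping.keys (mon_val s m) \<subseteq> {m. mdeg m \<le> 1}"
      using keys_mon_val_mons[of m s UNIV] assms(1) by (auto simp: mons_def)
    then show "Poly_Mapping.keys (const (Poly_Mapping.lookup p m) * mon_val s m) \<subseteq> {m. mdeg m \<le> 1}"
      using keys_cscale[of "Poly_Mapping.lookup p m" "mon_val s m"] by (auto simp: cscale_def)
  qed
  then show ?thesis by (auto simp: affine_linear_def)
qed

section \<open>Joining two circuits\<close>

fun relabel :: "(nat \<Rightarrow> nat) \<Rightarrow> gate \<Rightarrow> gate" where
  "relabel f (Input p) = Input p"
| "relabel f (Plus a u b v) = Plus a (f u) b (f v)"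
| "relabel f (Times a u b v) = Times a (f u) b (f v)"

lemma preds_relabel [simp]: "preds (relabel f g) = f ` preds g"
  by (cases g) auto

lemma gate_val_relabel: "gate_val val (relabel f g) = gate_val (\<lambda>v. val (f v)) g"
  by (cases g) auto

lemma relabel_eq_Input [simp]: "relabel f g = Input p \<longleftrightarrow> g = Input p"
  by (cases g) auto

text \<open>The two circuits are placed on the odd and on the positive even numbers, and the new
  output vertex is \<open>0\<close>.\<close>

lemma has_circuit_combine:
  assumes "has_circuit s p" "has_circuit t q"
    and G: "\<And>u v. preds (G u v) = {u, v}" "\<And>val u v. gate_val val (G u v) = h (val u) (val v)"
  shows "has_circuit (s + t + 1) (h p q)"
proof -
  obtain V1 L1 where 1: "is_circuit V1 L1" "computes V1 L1 p" "card V1 = s"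
    using assms(1) unfolding has_circuit_def by blast
  obtain V2 L2 where 2: "is_circuit V2 L2" "computes V2 L2 q" "card V2 = t"
    using assms(2) unfolding has_circuit_def by blast
  obtain val1 w1 where val1: "\<And>v. v \<in> V1 \<Longrightarrow> val1 v = gate_val val1 (L1 v)"
    "is_output V1 L1 w1" "val1 w1 = p"
    using 1(2) unfolding computes_def by blast
  obtain val2 w2 where val2: "\<And>v. v \<in> V2 \<Longrightarrow> val2 v = gate_val val2 (L2 v)"
    "is_output V2 L2 w2" "val2 w2 = q"
    using 2(2) unfolding computes_def by blast
  have uniq1: "w = w1" if "is_output V1 L1 w" for w
    using that 1(1) val1(2) unfolding is_circuit_def by blast
  have uniq2: "w = w2" if "is_output V2 L2 w" for w
    using that 2(1) val2(2) unfolding is_circuit_def by blast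
  define f1 :: "nat \<Rightarrow> nat" where "f1 x = 2 * x + 1" for x
  define f2 :: "nat \<Rightarrow> nat" where "f2 x = 2 * x + 2" for x
  have inj: "f1 x = f1 y \<longleftrightarrow> x = y" "f2 x = f2 y \<longleftrightarrow> x = y" for x y
    by (auto simp: f1_def f2_def)
  have ne: "f1 x \<noteq> f2 y" "f2 y \<noteq> f1 x" "f1 x \<noteq> 0" "f2 x \<noteq> 0" "0 \<noteq> f1 x" "0 \<noteq> f2 x" for x y
    unfolding f1_def f2_def by presburger+
  define V where "V = insert 0 (f1 ` V1 \<union> f2 ` V2)"
  define L where "L x = (if x = 0 then G (f1 w1) (f2 w2)
    else if odd x then relabel f1 (L1 ((x - 1) div 2)) else relabel f2 (L2 ((x - 2) div 2)))" for x
  define val where "val x = (if x = 0 then h p q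
    else if odd x then val1 ((x - 1) div 2) else val2 ((x - 2) div 2))" for x
  have L: "L 0 = G (f1 w1) (f2 w2)" "L (f1 x) = relabel f1 (L1 x)" "L (f2 x) = relabel f2 (L2 x)" for x
    by (auto simp: L_def f1_def f2_def)
  have val: "val 0 = h p q" "val (f1 x) = val1 x" "val (f2 x) = val2 x" for x
    by (auto simp: val_def f1_def f2_def)
  have w: "w1 \<in> V1" "w2 \<in> V2"
    using val1(2) val2(2) by (auto simp: is_output_def)
  let ?E = "circuit_edges V L" and ?E1 = "circuit_edges V1 L1" and ?E2 = "circuit_edges V2 L2"
  have E: "(x, y) \<in> ?E \<longleftrightarrow> (y = 0 \<and> (x = f1 w1 \<or> x = f2 w2)) \<or>
      (\<exists>a b. x = f1 a \<and> y = f1 b \<and> (a, b) \<in> ?E1) \<or> (\<exists>a b. x = f2 a \<and> y = f2 b \<and> (a, b) \<in> ?E2)" for x y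
    by (auto simp: circuit_edges_def V_def L G(1) ne inj)
  \<comment> \<open>No edge leaves the vertex 0, so a path either ends there, coming from elsewhere,
    or stays within one copy. A cycle would thus be a cycle of one of the given circuits.\<close>
  have trancl: "(y = 0 \<and> x \<noteq> 0) \<or> (\<exists>a b. x = f1 a \<and> y = f1 b \<and> (a, b) \<in> ?E1\<^sup>+) \<or>
      (\<exists>a b. x = f2 a \<and> y = f2 b \<and> (a, b) \<in> ?E2\<^sup>+)" if "(x, y) \<in> ?E\<^sup>+" for x y
    using that
  proof (induction rule: trancl_induct)
    case (base y)
    then show ?case unfolding E using ne(3,4) by (blast intro: r_into_trancl)
  next
    case (step y z)
    from step.hyps(2) show ?case
      unfolding E
    proof (elim disjE exE conjE)
      fix a b assume "y = f1 a" "z = f1 b" "(a, b) \<in> ?E1"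
      with step.IH show ?thesis by (auto simp: ne inj intro: trancl_into_trancl)
    next
      fix a b assume "y = f2 a" "z = f2 b" "(a, b) \<in> ?E2"
      with step.IH show ?thesis by (auto simp: ne inj intro: trancl_into_trancl)
    qed (use step.IH in \<open>auto simp: f1_def f2_def\<close>)
  qed
  have acyclic: "acyclic ?E"
    unfolding acyclic_def
  proof (intro allI notI)
    fix x assume "(x, x) \<in> ?E\<^sup>+"
    from trancl[OF this] show False
      using 1(1) 2(1) by (auto simp: is_circuit_def acyclic_def inj)
  qed
  have out: "is_output V L x \<longleftrightarrow> x = 0" for x
  proof
    assume "x = 0"
    moreover have "(0, v) \<notin> ?E" for v by (simp add: E ne)
    moreover have "0 \<in> V" by (simp add: V_def)
    ultimately show "is_output V L x" by (simp add: is_output_def)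
  next
    \<comment> \<open>Any other output would be the output of one of the given circuits, but those
      now have an edge to 0.\<close>
    assume x: "is_output V L x"
    then have x': "x \<in> V" "\<And>v. (x, v) \<notin> ?E" by (auto simp: is_output_def)
    show "x = 0"
    proof (rule ccontr)
      assume "x \<noteq> 0"
      then consider a where "a \<in> V1" "x = f1 a" | a where "a \<in> V2" "x = f2 a"
        using x'(1) by (auto simp: V_def)
      then show False
      proof cases
        case 1
        have "is_output V1 L1 a"
          unfolding is_output_def using 1 x'(2) by (auto simp: E)
        then show False using uniq1 1 x'(2)[of 0] by (auto simp: E)
      next
        case 2
        have "is_output V2 L2 a"
          unfolding is_output_def using 2 x'(2) by (auto simp: E)
        then show False using uniq2 2 x'(2)[of 0] by (auto simp: E)
      qed
    qed
  qed
  have fin: "finite V1" "finite V2"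
    and preds1: "u \<in> preds (L1 v) \<Longrightarrow> v \<in> V1 \<Longrightarrow> u \<in> V1"
    and preds2: "u \<in> preds (L2 v) \<Longrightarrow> v \<in> V2 \<Longrightarrow> u \<in> V2" for u v
    using 1(1) 2(1) by (auto simp: is_circuit_def)
  have "is_circuit V L"
    unfolding is_circuit_def out
  proof (intro conjI ballI allI impI acyclic)
    show "finite V" using fin by (simp add: V_def)
    show "preds (L v) \<subseteq> V" if v: "v \<in> V" for v
    proof -
      consider "v = 0" | x where "v = f1 x" "x \<in> V1" | x where "v = f2 x" "x \<in> V2"
        using v by (auto simp: V_def)
      then show ?thesis
      proof cases
        case 1
        then show ?thesis using w by (simp add: V_def L G(1))
      next
        case (2 x)
        then show ?thesis using preds1[of _ x] by (auto simp: V_def L)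
      next
        case (3 x)
        then show ?thesis using preds2[of _ x] by (auto simp: V_def L)
      qed
    qed
    show "\<exists>!w. w = (0::nat)" by simp
    show "affine_linear r" if "v \<in> V" "L v = Input r" for v r
      using that 1(1) 2(1) G(1)[of "f1 w1" "f2 w2"] unfolding V_def is_circuit_def by (auto simp: L)
  qed
  moreover have "computes V L (h p q)"
    unfolding computes_def out
  proof (intro exI[of _ val] conjI ballI)
    show "val v = gate_val val (L v)" if "v \<in> V" for v
      using that val1(1) val2(1)
      by (auto simp: V_def L val G(2) val1(3) val2(3) gate_val_relabel)
  qed (auto simp: val)
  moreover have "card V = s + t + 1"
  proof -
    have "card (f1 ` V1) = s" "card (f2 ` V2) = t"
      using 1(3) 2(3) by (auto simp: card_image inj_on_def inj)
    moreover have "f1 ` V1 \<inter> f2 ` V2 = {}" "0 \<notin> f1 ` V1 \<union> f2 ` V2"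
      by (auto simp: ne)
    ultimately show ?thesis
      using fin by (simp add: V_def card_Un_disjoint)
  qed
  ultimately show ?thesis
    unfolding has_circuit_def by blast
qed

lemma has_circuit_lincomb:
  assumes "has_circuit s p" "has_circuit t q"
  shows "has_circuit (s + t + 1) (cscale a p + cscale b q)"
  using has_circuit_combine[OF assms, of "\<lambda>u v. Plus a u b v" "\<lambda>p q. cscale a p + cscale b q"] by simp

lemma has_circuit_times:
  assumes "has_circuit s p" "has_circuit t q"
  shows "has_circuit (s + t + 1) (p * q)"
  using has_circuit_combine[OF assms, of "\<lambda>u v. Times 1 u 1 v" "\<lambda>p q. p * q"] by simp

lemma has_circuit_const: "has_circuit 1 (const a)"
  by (rule has_circuit_input) (auto simp: affine_linear_def const_def split: if_splits)

text \<open>Every summand costs its own circuit and one addition gate; the final 1 is the input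
  vertex 0 with which the sum starts. The scalars sit on edges and are free.\<close>

lemma has_circuit_sum_cscale:
  assumes "finite B" "\<And>b. b \<in> B \<Longrightarrow> has_circuit s b"
  shows "has_circuit (card B * (s + 1) + 1) (\<Sum>b\<in>B. cscale (u b) b)"
  using assms
proof (induction B rule: finite_induct)
  case empty
  then show ?case using has_circuit_const[of 0] by simp
next
  case (insert b B)
  then have "has_circuit (s + (card B * (s + 1) + 1) + 1) (cscale (u b) b + cscale 1 (\<Sum>b\<in>B. cscale (u b) b))"
    by (intro has_circuit_lincomb) auto
  then show ?case using insert by (simp add: add_ac)
qed

text \<open>Ensures that the \<open>LEAST\<close> in \<open>cc\<close> is attained. The
  metapolynomial is written as a substitution of the variables into itself, which exposes its sums,
  products and powers.\<close>

lemma ex_has_circuit: "\<exists>s. has_circuit s \<Delta>"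
proof -
  have add: "\<exists>s. has_circuit s (p + q)" if "\<exists>s. has_circuit s p" "\<exists>s. has_circuit s q" for p q
    using that has_circuit_lincomb[of _ p _ q 1 1] by auto
  have mult: "\<exists>s. has_circuit s (p * q)" if "\<exists>s. has_circuit s p" "\<exists>s. has_circuit s q" for p q
    using that has_circuit_times by blast
  have const: "\<exists>s. has_circuit s (const a)" for a
    using has_circuit_const by blast
  have var: "\<exists>s. has_circuit s (var v)" for v
    by (intro exI[of _ 1] has_circuit_input) (auto simp: affine_linear_def var_def)
  have power: "\<exists>s. has_circuit s (p ^ n)" if "\<exists>s. has_circuit s p" for p n
    using const[of 1] by (induction n) (auto intro!: mult that)
  have prod: "\<exists>s. has_circuit s (prod f S)" if "\<And>x. x \<in> S \<Longrightarrow> \<exists>s. has_circuit s (f x)" for f and S :: "(nat \<Rightarrow>\<^sub>0 nat) set"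
    using that const[of 1] by (induction S rule: infinite_finite_induct) (auto intro!: mult)
  have sum: "\<exists>s. has_circuit s (sum f S)" if "\<And>x. x \<in> S \<Longrightarrow> \<exists>s. has_circuit s (f x)" for f and S :: "((nat \<Rightarrow>\<^sub>0 nat) \<Rightarrow>\<^sub>0 nat) set"
    using that const[of 0] by (induction S rule: infinite_finite_induct) (auto intro!: add)
  have "\<Delta> = mp_subst var \<Delta>"
    by (subst poly_mapping_expand[of \<Delta>]) (simp add: mp_subst_def mon_val_var const_def mult_single)
  moreover have "\<exists>s. has_circuit s (mp_subst var \<Delta>)"
    unfolding mp_subst_def mon_val_def by (intro sum mult prod power var const)
  ultimately show ?thesis by simp
qed

section \<open>Highest weight vectors and irreducible subrepresentations\<close>

lemma mmult_diag_left: "i < k \<Longrightarrow> mmult k (diag t) A i j = t i * A i j"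
  unfolding mmult_def diag_def by (subst sum.remove[of _ i]) (auto intro!: sum.neutral)

lemma mmult_diag_right: "j < k \<Longrightarrow> mmult k A (diag t) i j = A i j * t j"
  unfolding mmult_def diag_def by (subst sum.remove[of _ j]) (auto intro!: sum.neutral)

lemma subrep_metapolys: "subrep \<delta> d k U \<Longrightarrow> \<Delta> \<in> U \<Longrightarrow> \<Delta> \<in> metapolys \<delta> d k"
  by (auto simp: subrep_def)

lemma subrep_subspace: "subrep \<delta> d k U \<Longrightarrow> cmpoly.subspace U"
  by (simp add: subrep_def)

text \<open>The inverse \<open>B\<close> is an explicit witness, which stands in for membership in
  \<open>GL k\<close> when matrices are functions.\<close>

lemma subrep_mat_act:
  assumes "subrep \<delta> d k U" "\<Delta> \<in> U"
    and "\<And>i j. i < k \<Longrightarrow> j < k \<Longrightarrow> mmult k A B i j = diag (\<lambda>_. 1) i j"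
    and "\<And>i j. i < k \<Longrightarrow> j < k \<Longrightarrow> mmult k B A i j = diag (\<lambda>_. 1) i j"
  shows "mat_act d k A \<Delta> \<in> U"
proof -
  let ?m = "\<lambda>A. mat k k (\<lambda>(i, j). A i j) :: complex mat"
  have mult: "?m A * ?m B = ?m (mmult k A B)" for A B
    by (rule eq_matI) (auto simp: scalar_prod_def mmult_def lessThan_atLeast0)
  have one: "?m C = 1\<^sub>m k" if "\<And>i j. i < k \<Longrightarrow> j < k \<Longrightarrow> C i j = diag (\<lambda>_. 1) i j" for C
    by (rule eq_matI) (auto simp: that diag_def)
  have "?m A \<in> carrier (GL k)"
    unfolding GL_iff using one[OF assms(3)] one[OF assms(4)] mult
    by (auto intro!: bexI[of _ "?m B"])
  moreover from meta_act_eq_mat_act[OF this] have "meta_act d k (?m A) = mat_act d k A"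
    by (auto intro: mat_act_cong)
  ultimately show ?thesis
    using assms(1,2) by (metis subrep_def)
qed

lemma subrep_diag:
  assumes "subrep \<delta> d k U" "\<Delta> \<in> U" "\<And>i. i < k \<Longrightarrow> t i \<noteq> 0"
  shows "mat_act d k (diag t) \<Delta> \<in> U"
  using assms(1,2)
  by (rule subrep_mat_act[where B = "diag (\<lambda>i. inverse (t i))"])
    (auto simp: mmult_diag_left assms(3) diag_def)

text \<open>Replaces a Vandermonde determinant. Passing from p(x) to p(2x) - 2^(E+1) p(x) removes
  the top coefficient and multiplies the coefficient of index e by 2^e - 2^(E+1), which is nonzero,
  so induction on the degree applies.\<close>

lemma subspace_coefficients:
  assumes "cmpoly.subspace U"
    and "\<And>x. x \<noteq> 0 \<Longrightarrow> (\<Sum>e\<le>E. cscale (x ^ e) (v e)) \<in> U"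
    and "e \<le> E"
  shows "v e \<in> U"
  using assms(2,3)
proof (induction E arbitrary: v e)
  case 0
  then show ?case using "0.prems"(1)[of 1] by simp
next
  case (Suc E)
  let ?p = "\<lambda>x. \<Sum>e\<le>Suc E. cscale (x ^ e) (v e)"
  have coeff: "v e \<in> U" if "e \<le> E" for e
  proof -
    have "(\<Sum>e\<le>E. cscale (x ^ e) (cscale (2 ^ e - 2 ^ Suc E) (v e))) \<in> U" if "x \<noteq> 0" for x
    proof -
      have "?p (2 * x) - cscale (2 ^ Suc E) (?p x)
        = (\<Sum>e\<le>Suc E. cscale (x ^ e) (cscale (2 ^ e - 2 ^ Suc E) (v e)))"
        unfolding cmpoly.scale_sum_right sum_subtractf[symmetric] cmpoly.scale_scale
          cmpoly.scale_left_diff_distrib[symmetric]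
        by (intro sum.cong refl arg_cong2[where f = cscale])
          (simp_all add: power_mult_distrib right_diff_distrib mult.commute del: power_Suc)
      also have "\<dots> = (\<Sum>e\<le>E. cscale (x ^ e) (cscale (2 ^ e - 2 ^ Suc E) (v e)))"
        by simp
      finally have "(\<Sum>e\<le>E. cscale (x ^ e) (cscale (2 ^ e - 2 ^ Suc E) (v e)))
          = ?p (2 * x) - cscale (2 ^ Suc E) (?p x)" ..
      moreover have "?p (2 * x) \<in> U" by (rule Suc.prems(1)) (use that in simp)
      moreover have "cscale (2 ^ Suc E) (?p x) \<in> U"
        by (rule cmpoly.subspace_scale[OF assms(1) Suc.prems(1)[OF that]])
      ultimately show ?thesis
        using cmpoly.subspace_diff[OF assms(1)] by (simp only:)
    qed
    from Suc.IH[OF this \<open>e \<le> E\<close>] have "cscale (2 ^ e - 2 ^ Suc E) (v e) \<in> U" .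
    then have "cscale (1 / (2 ^ e - 2 ^ Suc E)) (cscale (2 ^ e - 2 ^ Suc E) (v e)) \<in> U"
      using assms(1) cmpoly.subspace_scale by blast
    moreover have "(2 :: complex) ^ e \<noteq> 2 ^ Suc E"
    proof -
      have "(2 :: nat) ^ e \<noteq> 2 ^ Suc E"
        using \<open>e \<le> E\<close> by (simp del: power_Suc)
      then have "of_nat (2 ^ e) \<noteq> (of_nat (2 ^ Suc E) :: complex)"
        unfolding of_nat_eq_iff .
      then show ?thesis by simp
    qed
    ultimately show ?thesis by simp
  qed
  show ?case
  proof (cases "e \<le> E")
    case False
    then have "e = Suc E" using Suc.prems by simp
    moreover have "?p 1 - (\<Sum>e\<le>E. v e) \<in> U"
      using coeff by (intro cmpoly.subspace_diff cmpoly.subspace_sum assms(1) Suc.prems(1)) auto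
    ultimately show ?thesis by simp
  qed (rule coeff)
qed

definition part :: "(('v \<Rightarrow>\<^sub>0 nat) \<Rightarrow> bool) \<Rightarrow> 'v cmpoly \<Rightarrow> 'v cmpoly" where
  "part P p = (\<Sum>m\<in>Poly_Mapping.keys p. if P m then Poly_Mapping.single m (Poly_Mapping.lookup p m) else 0)"

lemma lookup_part: "Poly_Mapping.lookup (part P p) m = (if P m then Poly_Mapping.lookup p m else 0)"
proof -
  have "Poly_Mapping.lookup (part P p) m
    = (\<Sum>m'\<in>Poly_Mapping.keys p. if m' = m then if P m then Poly_Mapping.lookup p m else 0 else 0)"
    unfolding part_def lookup_sum by (intro sum.cong) (auto simp: lookup_single when_def)
  then show ?thesis by (auto simp: in_keys_iff)
qed

lemma keys_part: "Poly_Mapping.keys (part P p) = {m \<in> Poly_Mapping.keys p. P m}"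
  by (auto simp: in_keys_iff lookup_part split: if_splits)

lemma part_neq_0: "m \<in> Poly_Mapping.keys p \<Longrightarrow> P m \<Longrightarrow> part P p \<noteq> 0"
  using keys_part[of P p] by auto

text \<open>The diagonal matrix with entries \<open>x ^ c i\<close> multiplies a monomial by x to
  the power \<open>\<Sum>i<k. c i * weight m i\<close>. The required part is therefore a coefficient
  of a polynomial in x whose values at nonzero x lie in \<open>U\<close>.\<close>

lemma subrep_part:
  assumes U: "subrep \<delta> d k U" "\<Delta> \<in> U"
  shows "part (\<lambda>m. (\<Sum>i<k. c i * weight m i) = a) \<Delta> \<in> U"
proof -
  let ?w = "\<lambda>m. \<Sum>i<k. c i * weight m i"
  \<comment> \<open>Any bound on the occurring exponents would do; adding \<open>a\<close> keeps
    \<open>a\<close> in range even if no monomial has this exponent.\<close>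
  define E where "E = a + (\<Sum>m\<in>Poly_Mapping.keys \<Delta>. ?w m)"
  have le: "?w m \<le> E" if "m \<in> Poly_Mapping.keys \<Delta>" for m
    using that member_le_sum[of m "Poly_Mapping.keys \<Delta>" ?w] by (simp add: E_def)
  have "(\<Sum>e\<le>E. cscale (x ^ e) (part (\<lambda>m. ?w m = e) \<Delta>)) = mat_act d k (diag (\<lambda>i. x ^ c i)) \<Delta>" for x
  proof (rule poly_mapping_eqI)
    fix m
    have "Poly_Mapping.lookup (\<Sum>e\<le>E. cscale (x ^ e) (part (\<lambda>m. ?w m = e) \<Delta>)) m
        = (\<Sum>e\<le>E. if e = ?w m then x ^ ?w m * Poly_Mapping.lookup \<Delta> m else 0)"
      unfolding lookup_sum by (intro sum.cong) (auto simp: lookup_cscale lookup_part)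
    also have "\<dots> = x ^ ?w m * Poly_Mapping.lookup \<Delta> m"
      using le[of m] by (auto simp: in_keys_iff)
    finally show "Poly_Mapping.lookup (\<Sum>e\<le>E. cscale (x ^ e) (part (\<lambda>m. ?w m = e) \<Delta>)) m
        = Poly_Mapping.lookup (mat_act d k (diag (\<lambda>i. x ^ c i)) \<Delta>) m"
      using subrep_metapolys[OF U] by (simp add: lookup_mat_act_diag power_mult[symmetric] power_sum)
  qed
  then have "(\<Sum>e\<le>E. cscale (x ^ e) (part (\<lambda>m. ?w m = e) \<Delta>)) \<in> U" if "x \<noteq> 0" for x
    using subrep_diag[OF U, of "\<lambda>i. x ^ c i"] that by simp
  from subspace_coefficients[OF subrep_subspace[OF U(1)] this, of a]
  show ?thesis by (simp add: E_def)
qed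

lemma constant_off_0_imp_eq:
  fixes f :: "complex \<Rightarrow> complex"
  assumes "isCont f 0" "\<And>x. x \<noteq> 0 \<Longrightarrow> f x = a"
  shows "f 0 = a"
proof -
  have "(f \<longlongrightarrow> a) (at 0)"
    by (rule tendsto_eventually) (auto simp: eventually_at_filter assms(2))
  then show ?thesis
    using assms(1) LIM_unique unfolding isCont_def by blast
qed

text \<open>Among the weights of \<open>U\<close>, a weight \<open>l\<close> maximising \<open>\<Sum>i<k. (k - i) * l i\<close> is a highest
  weight. Conjugating an upper triangular matrix by \<open>diag (x ^ (k - i))\<close> multiplies its
  \<open>(i, j)\<close> entry by \<open>x ^ (j - i)\<close>, so that it degenerates to its diagonal as \<open>x\<close> tends to
  \<open>0\<close>; by maximality the action on the weight vector is not changed in the limit.\<close>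

lemma ex_highest_weight_vector:
  assumes U: "subrep \<delta> d k U" and "U \<noteq> {0}"
  shows "\<exists>l\<in>partitions (\<delta> * d) k. \<exists>\<Delta>\<in>U. highest_weight_vector d k l \<Delta>"
proof -
  let ?phi = "\<lambda>m. \<Sum>i<k. (k - i) * weight m i"
  define P where "P e \<longleftrightarrow> (\<exists>u\<in>U. u \<noteq> 0 \<and> (\<forall>m\<in>Poly_Mapping.keys u. ?phi m = e))" for e
  have in_mons: "m \<in> mons (exponents d k) \<delta>" if "u \<in> U" "m \<in> Poly_Mapping.keys u" for u m
    using subrep_metapolys[OF U that(1)] that(2) by (auto simp: metapolys_eq_mons)
  \<comment> \<open>Every level of \<open>?phi\<close> that occurs in an element of \<open>U\<close>
    is attained by a vector of \<open>U\<close> lying wholly in that level, hence will be at most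
    the maximum \<open>\<Phi>\<close>.\<close>
  have P_phi: "P (?phi m)" if "u \<in> U" "m \<in> Poly_Mapping.keys u" for u m
  proof -
    let ?u = "part (\<lambda>m'. ?phi m' = ?phi m) u"
    have "?u \<in> U" by (rule subrep_part[OF U that(1)])
    moreover have "?u \<noteq> 0" by (rule part_neq_0[OF that(2)]) simp
    moreover have "\<forall>m'\<in>Poly_Mapping.keys ?u. ?phi m' = ?phi m" by (simp add: keys_part)
    ultimately show ?thesis unfolding P_def by blast
  qed
  have "0 \<in> U" using subrep_subspace[OF U] cmpoly.subspace_0 by blast
  then obtain u0 where u0: "u0 \<in> U" "u0 \<noteq> 0" using assms(2) by blast
  then obtain m0 where "m0 \<in> Poly_Mapping.keys u0" by fastforce
  then have "P (?phi m0)" using P_phi u0 by blast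
  moreover have P_le: "e \<le> k * (\<delta> * d)" if P_e: "P e" for e
  proof -
    obtain u where u: "u \<in> U" "u \<noteq> 0" "\<forall>m\<in>Poly_Mapping.keys u. ?phi m = e"
      using P_e unfolding P_def by blast
    then obtain m where m: "m \<in> Poly_Mapping.keys u" by fastforce
    have "e = ?phi m" using u(3) m by simp
    also have "\<dots> \<le> (\<Sum>i<k. k * weight m i)" by (intro sum_mono) auto
    also have "\<dots> = k * (\<delta> * d)"
      using sum_weight[OF in_mons[OF u(1) m]] by (simp add: sum_distrib_left[symmetric])
    finally show ?thesis .
  qed
  ultimately obtain \<Phi> where \<Phi>: "P \<Phi>" "\<And>e. P e \<Longrightarrow> e \<le> \<Phi>"
    using GreatestI_nat[of P _ "k * (\<delta> * d)"] Greatest_le_nat[of P _ "k * (\<delta> * d)"] by metis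
  \<comment> \<open>Several weights may share the value \<open>\<Phi>\<close>. Cutting down one
    coordinate at a time leaves a vector of a single weight.\<close>
  have "\<exists>v\<in>U. v \<noteq> 0 \<and> (\<forall>m\<in>Poly_Mapping.keys v. ?phi m = \<Phi>) \<and>
      (\<exists>w. \<forall>m\<in>Poly_Mapping.keys v. \<forall>i<n. weight m i = w i)" if "n \<le> k" for n
    using that
  proof (induction n)
    case 0
    then show ?case using \<Phi>(1) by (auto simp: P_def)
  next
    case (Suc n)
    then obtain v w where v: "v \<in> U" "v \<noteq> 0" "\<forall>m\<in>Poly_Mapping.keys v. ?phi m = \<Phi>"
      "\<forall>m\<in>Poly_Mapping.keys v. \<forall>i<n. weight m i = w i"
      by auto
    then obtain m1 where m1: "m1 \<in> Poly_Mapping.keys v" by fastforce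
    have coord: "(\<Sum>i<k. of_bool (i = n) * weight m i) = weight m n" for m
      using Suc.prems by (subst sum.remove[of _ n]) (auto intro!: sum.neutral)
    let ?v = "part (\<lambda>m. weight m n = weight m1 n) v"
    have "?v \<in> U"
      using subrep_part[OF U v(1), of "\<lambda>i. of_bool (i = n)" "weight m1 n"] by (simp only: coord)
    moreover have "?v \<noteq> 0" by (rule part_neq_0[OF m1]) simp
    moreover have "\<forall>m\<in>Poly_Mapping.keys ?v. \<forall>i<Suc n. weight m i = (w(n := weight m1 n)) i"
      using v(4) by (auto simp: keys_part less_Suc_eq)
    moreover have "\<forall>m\<in>Poly_Mapping.keys ?v. ?phi m = \<Phi>"
      using v(3) by (simp add: keys_part)
    ultimately show ?case by blast
  qed
  from this[of k] obtain v w where v: "v \<in> U" "v \<noteq> 0" "\<And>m. m \<in> Poly_Mapping.keys v \<Longrightarrow> ?phi m = \<Phi>"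
    and w: "\<And>m i. m \<in> Poly_Mapping.keys v \<Longrightarrow> i < k \<Longrightarrow> weight m i = w i"
    by auto
  obtain m1 where m1: "m1 \<in> Poly_Mapping.keys v" using v(2) by fastforce
  define l where "l = weight m1"
  have l: "weight m i = l i" if "m \<in> Poly_Mapping.keys v" "i < k" for m i
    using w that m1 by (simp add: l_def)
  have \<Phi>_l: "\<Phi> = (\<Sum>i<k. (k - i) * l i)" using v(3)[OF m1] by (simp add: l_def)
  have v_meta: "v \<in> metapolys \<delta> d k" using subrep_metapolys[OF U v(1)] .
  have diag_v: "mat_act d k (diag t) v = cscale (\<Prod>i<k. t i ^ l i) v" for t
  proof (rule poly_mapping_eqI)
    fix m
    show "Poly_Mapping.lookup (mat_act d k (diag t) v) m
        = Poly_Mapping.lookup (cscale (\<Prod>i<k. t i ^ l i) v) m"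
      by (cases "m \<in> Poly_Mapping.keys v")
        (simp_all add: lookup_mat_act_diag[OF v_meta] lookup_cscale l, simp add: in_keys_iff)
  qed
  have pow_phi: "(\<Prod>i<k. (x ^ (k - i)) ^ weight m i) = x ^ ?phi m" for x :: complex and m
    by (simp add: power_mult[symmetric] power_sum)

  \<comment> \<open>The permutation matrix exchanging i and i + 1 carries \<open>v\<close> to a
    vector of \<open>U\<close> whose weight is \<open>l\<close> with these two entries swapped.
    Maximality of \<open>\<Phi>\<close> then compares exactly these two entries.\<close>
  have "l (Suc i) \<le> l i" for i
  proof (cases "Suc i < k")
    case False
    then show ?thesis
      using weight_eq_0[OF in_mons[OF v(1) m1]] by (simp add: l_def)
  next
    case True
    define s where "s a = (if a = i then Suc i else if a = Suc i then i else a)" for a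
    have ss: "s (s a) = a" and s_less: "a < k \<Longrightarrow> s a < k" for a
      using True by (auto simp: s_def)
    define A where "A a b = (if b = s a then 1 else (0::complex))" for a b
    have A_mult: "mmult k A B a b = B (s a) b" if "a < k" for a b B
      using that s_less unfolding mmult_def A_def
      by (subst sum.remove[of _ "s a"]) (auto intro!: sum.neutral)
    have A_A: "mmult k A A a b = diag (\<lambda>_. 1) a b" if "a < k" for a b
      using A_mult[OF that] by (simp add: A_def ss diag_def eq_commute)
    let ?v = "mat_act d k A v"
    have v'_U: "?v \<in> U" using A_A by (intro subrep_mat_act[OF U v(1), of A A]) auto
    have "mat_act d k A ?v = v"
      using mat_act_cong[of k "mmult k A A" "diag (\<lambda>_. 1)" d] A_A mat_act_one[OF v_meta]
      by (simp add: mat_act_mat_act)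
    then have "?v \<noteq> 0" using v(2) by auto
    have torus: "mat_act d k (diag t) ?v = cscale (\<Prod>a<k. t (s a) ^ l a) ?v" for t
    proof -
      have "mmult k (diag t) A a b = mmult k A (diag (\<lambda>a. t (s a))) a b" if "a < k" "b < k" for a b
        using that by (auto simp: mmult_diag_left mmult_diag_right A_def ss)
      then have "mat_act d k (diag t) ?v = mat_act d k A (mat_act d k (diag (\<lambda>a. t (s a))) v)"
        unfolding mat_act_mat_act by (subst mat_act_cong) auto
      then show ?thesis by (simp add: diag_v mat_act_cscale)
    qed
    let ?e = "\<Sum>a<k. (k - s a) * l a"
    have "?phi m = ?e" if "m \<in> Poly_Mapping.keys ?v" for m
    proof -
      \<comment> \<open>One torus element suffices: distinct powers of 2 differ, so the eigenvalue
        determines the level.\<close>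
      have "2 ^ ?phi m * Poly_Mapping.lookup ?v m = 2 ^ ?e * Poly_Mapping.lookup ?v m"
        using arg_cong[OF torus[of "\<lambda>a. 2 ^ (k - a)"], of "\<lambda>p. Poly_Mapping.lookup p m"]
        by (simp add: lookup_mat_act_diag[OF subrep_metapolys[OF U v'_U]] lookup_cscale
            power_mult[symmetric] power_sum)
      then have "(2::complex) ^ ?phi m = 2 ^ ?e" using that by (simp add: in_keys_iff)
      then have "of_nat (2 ^ ?phi m) = (of_nat (2 ^ ?e) :: complex)" by simp
      then have "(2::nat) ^ ?phi m = 2 ^ ?e" unfolding of_nat_eq_iff .
      then show ?thesis by (rule power_inject_exp[THEN iffD1, rotated]) simp
    qed
    then have "P ?e" unfolding P_def using v'_U \<open>?v \<noteq> 0\<close> by blast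
    then have le: "?e \<le> (\<Sum>a<k. (k - a) * l a)" using \<Phi>(2) \<Phi>_l by blast
    have split: "(\<Sum>a<k. f a) = f i + f (Suc i) + (\<Sum>a\<in>{..<k} - {i} - {Suc i}. f a)" for f :: "nat \<Rightarrow> nat"
      using True by (subst sum.remove[of _ i], simp, simp, subst sum.remove[of _ "Suc i"]) auto
    have "(\<Sum>a\<in>{..<k} - {i} - {Suc i}. (k - s a) * l a) = (\<Sum>a\<in>{..<k} - {i} - {Suc i}. (k - a) * l a)"
      by (intro sum.cong) (auto simp: s_def)
    then have "(k - Suc i) * l i + (k - i) * l (Suc i) \<le> (k - i) * l i + (k - Suc i) * l (Suc i)"
      using le unfolding split by (simp add: s_def)
    moreover have "k - i = Suc (k - Suc i)" using True by simp
    ultimately show ?thesis by simp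
  qed
  then have "l \<in> partitions (\<delta> * d) k"
    using sum_weight[OF in_mons[OF v(1) m1]] weight_eq_0[OF in_mons[OF v(1) m1]]
    by (auto simp: partitions_def l_def intro!: decseq_SucI)
  moreover have "highest_weight_vector d k l v"
    unfolding highest_weight_vector_def
  proof (intro conjI ballI impI v(2))
    fix g :: "complex mat" assume g: "g \<in> carrier (GL k)" "upper_triangular g"
    then have "g \<in> carrier_mat k k" by (simp add: GL_iff)
    then have g0: "g $$ (i, j) = 0" if "i < k" "j < i" for i j
      using g(2) that by auto
    let ?g = "\<lambda>i j. g $$ (i, j)"
    let ?y = "mat_act d k ?g v"
    define G where "G x i j = (if i \<le> j then x ^ (j - i) * ?g i j else 0)" for x :: complex and i j
    have y_U: "?y \<in> U"
      using U g(1) v(1) by (metis subrep_def meta_act_eq_mat_act)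
    \<comment> \<open>The conjugation is written as an identity of products without inverses, with
      \<open>x ^ \<Phi>\<close> as the eigenvalue on \<open>v\<close>; so no negative power of
      \<open>x\<close> occurs.\<close>
    have conj: "mat_act d k (diag (\<lambda>i. x ^ (k - i))) ?y = cscale (x ^ \<Phi>) (mat_act d k (G x) v)" for x
    proof -
      have "mmult k (diag (\<lambda>i. x ^ (k - i))) ?g i j = mmult k (G x) (diag (\<lambda>i. x ^ (k - i))) i j"
        if "i < k" "j < k" for i j
        using that g0[of i j] by (auto simp: mmult_diag_left mmult_diag_right G_def power_add[symmetric])
      then have "mat_act d k (diag (\<lambda>i. x ^ (k - i))) ?y
          = mat_act d k (G x) (mat_act d k (diag (\<lambda>i. x ^ (k - i))) v)"
        unfolding mat_act_mat_act by (subst mat_act_cong) auto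
      also have "\<dots> = cscale (x ^ \<Phi>) (mat_act d k (G x) v)"
        by (simp add: diag_v mat_act_cscale \<Phi>_l power_mult[symmetric] power_sum)
      finally show ?thesis .
    qed
    have "Poly_Mapping.lookup ?y m = Poly_Mapping.lookup (mat_act d k (G 0) v) m" for m
    proof -
      let ?q = "\<lambda>x. Poly_Mapping.lookup (mat_act d k (G x) v) m"
      \<comment> \<open>Polynomial dependence on the entries makes each coefficient continuous in
        \<open>x\<close>.\<close>
      obtain c where c: "\<And>A. mat_act d k A v = (\<Sum>\<alpha>\<in>mons ({..<k} \<times> {..<k}) (\<delta> * d).
          cscale (mon_val (\<lambda>(i, j). A i j) \<alpha>) (c \<alpha>))"
        using poly_dependent_mat_act[OF v_meta] unfolding poly_dependent_def by metis
      have "isCont (\<lambda>x. G x i j) 0" for i j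
        unfolding G_def by (cases "i \<le> j") auto
      then have cont: "isCont ?q 0"
        unfolding c lookup_sum lookup_cscale mon_val_def
        by (intro continuous_intros) (auto simp: case_prod_beta)
      have eq: "x ^ ?phi m * Poly_Mapping.lookup ?y m = x ^ \<Phi> * ?q x" for x
        using arg_cong[OF conj[of x], of "\<lambda>p. Poly_Mapping.lookup p m"]
        by (simp add: lookup_mat_act_diag[OF subrep_metapolys[OF U y_U]] lookup_cscale pow_phi)
      show ?thesis
      proof (cases "Poly_Mapping.lookup ?y m = 0")
        case True
        then have "?q x = 0" if "x \<noteq> 0" for x using eq[of x] that by simp
        then show ?thesis using constant_off_0_imp_eq[OF cont] True by simp
      next
        case False
        \<comment> \<open>Maximality permits cancelling the power of \<open>x\<close> on the left.
          What remains equals a nonzero constant for nonzero \<open>x\<close>, hence also at 0,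
          which rules out a positive exponent \<open>\<Phi> - ?phi m\<close>.\<close>
        then have le: "?phi m \<le> \<Phi>" using \<Phi>(2) P_phi[OF y_U] by (simp add: in_keys_iff)
        then have off: "x ^ (\<Phi> - ?phi m) * ?q x = Poly_Mapping.lookup ?y m" if "x \<noteq> 0" for x
        proof -
          have "x ^ \<Phi> = x ^ ?phi m * x ^ (\<Phi> - ?phi m)" using le by (simp add: power_add[symmetric])
          then show ?thesis using eq[of x] that by simp
        qed
        have "isCont (\<lambda>x. x ^ (\<Phi> - ?phi m) * ?q x) 0"
          using cont by (intro continuous_intros)
        from constant_off_0_imp_eq[OF this off]
        have "0 ^ (\<Phi> - ?phi m) * ?q 0 = Poly_Mapping.lookup ?y m" .
        then show ?thesis using False by (cases "\<Phi> - ?phi m") auto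
      qed
    qed
    then have "?y = mat_act d k (G 0) v" by (rule poly_mapping_eqI)
    also have "\<dots> = mat_act d k (diag (\<lambda>i. ?g i i)) v"
      by (subst mat_act_cong[of k "G 0" "diag (\<lambda>i. ?g i i)"]) (auto simp: G_def diag_def)
    finally show "meta_act d k g v = cscale (\<Prod>i<k. g $$ (i, i) ^ l i) v"
      by (simp add: meta_act_eq_mat_act[OF g(1)] diag_v)
  qed
  ultimately show ?thesis using v(1) by blast
qed

section \<open>Irreducible subrepresentations and spans of orbits\<close>

lemma metapolys_subspace: "cmpoly.subspace (metapolys \<delta> d k)"
  unfolding metapolys_eq_mons cmpoly.subspace_def
  using keys_cscale Poly_Mapping.keys_add by fastforce

lemma metapolys_finite_span: "\<exists>T. finite T \<and> metapolys \<delta> d k \<subseteq> cmpoly.span T"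
proof (intro exI conjI subsetI)
  let ?T = "(\<lambda>m. Poly_Mapping.single m 1) ` mons (exponents d k) \<delta> :: metapoly set"
  show "finite ?T" by (simp add: finite_mons finite_exponents)
  fix p assume p: "p \<in> metapolys \<delta> d k"
  have "p = (\<Sum>m\<in>Poly_Mapping.keys p. cscale (Poly_Mapping.lookup p m) (Poly_Mapping.single m 1))"
    by (subst poly_mapping_expand[of p]) (simp add: cscale_def const_def mult_single)
  also have "\<dots> \<in> cmpoly.span ?T"
    using p by (intro cmpoly.span_sum cmpoly.span_scale cmpoly.span_base) (auto simp: metapolys_eq_mons)
  finally show "p \<in> cmpoly.span ?T" .
qed

text \<open>A nonzero subrepresentation of least dimension has no proper nonzero one: a basis of the
  smaller space extends to a basis of the larger, and both have the same finite size.\<close>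

lemma ex_irreducible_subrep:
  assumes "subrep \<delta> d k W" "W \<noteq> {0}"
  shows "\<exists>U\<subseteq>W. irreducible_subrep \<delta> d k U"
proof -
  let ?Q = "\<lambda>U. subrep \<delta> d k U \<and> U \<noteq> {0} \<and> U \<subseteq> W"
  obtain U where U: "?Q U" "\<And>U'. ?Q U' \<Longrightarrow> cmpoly.dim U \<le> cmpoly.dim U'"
    using ex_has_least_nat[of ?Q W cmpoly.dim] assms by blast
  obtain T where T: "finite T" "metapolys \<delta> d k \<subseteq> cmpoly.span T"
    using metapolys_finite_span by blast
  have "U' = U" if U': "subrep \<delta> d k U'" "U' \<subseteq> U" "U' \<noteq> {0}" for U'
  proof -
    obtain B' where B': "B' \<subseteq> U'" "cmpoly.independent B'" "U' \<subseteq> cmpoly.span B'" "card B' = cmpoly.dim U'"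
      using cmpoly.basis_exists by blast
    obtain B where B: "B' \<subseteq> B" "B \<subseteq> U" "cmpoly.independent B" "U \<subseteq> cmpoly.span B"
      using cmpoly.maximal_independent_subset_extend[of B' U] B' U'(2) by blast
    have "U \<subseteq> cmpoly.span T" using U(1) T(2) by (auto simp: subrep_def)
    then have "finite B" using cmpoly.independent_span_bound[OF T(1) B(3)] B(2) by blast
    moreover have "card B = cmpoly.dim U" using cmpoly.basis_card_eq_dim[OF B(2,4,3)] .
    ultimately have "B' = B"
      using U(2)[of U'] U' U(1) B(1) B'(4) by (intro card_seteq) auto
    then have "U \<subseteq> cmpoly.span B'" using B(4) by simp
    moreover have "cmpoly.span B' \<subseteq> U'"
      using B'(1) subrep_subspace[OF U'(1)] by (rule cmpoly.span_minimal)
    ultimately show ?thesis using U'(2) by blast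
  qed
  then show ?thesis using U(1) unfolding irreducible_subrep_def by blast
qed

definition orbit_span :: "nat \<Rightarrow> nat \<Rightarrow> metapoly \<Rightarrow> metapoly set" where
  "orbit_span d k \<Delta> = cmpoly.span ((\<lambda>g. meta_act d k g \<Delta>) ` carrier (GL k))"

lemma meta_act_meta_act:
  assumes "g \<in> carrier (GL k)" "h \<in> carrier (GL k)"
  shows "meta_act d k g (meta_act d k h \<Delta>) = meta_act d k (g \<otimes>\<^bsub>GL k\<^esub> h) \<Delta>"
proof -
  interpret group "GL k" by (rule group_GL)
  have "g \<in> carrier_mat k k" "h \<in> carrier_mat k k" using assms by (auto simp: GL_iff)
  then have "mat_act d k (mmult k (\<lambda>i j. g $$ (i, j)) (\<lambda>i j. h $$ (i, j))) = mat_act d k (\<lambda>i j. (g * h) $$ (i, j))"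
    by (intro mat_act_cong) (auto simp: mmult_def scalar_prod_def lessThan_atLeast0)
  then show ?thesis
    using assms m_closed[OF assms] by (simp add: meta_act_eq_mat_act mat_act_mat_act GL_mult)
qed

lemma subrep_orbit_span:
  assumes "\<Delta> \<in> metapolys \<delta> d k"
  shows "subrep \<delta> d k (orbit_span d k \<Delta>)"
proof -
  interpret group "GL k" by (rule group_GL)
  let ?O = "(\<lambda>g. meta_act d k g \<Delta>) ` carrier (GL k)"
  have "cmpoly.span ?O \<subseteq> metapolys \<delta> d k"
    using assms by (intro cmpoly.span_minimal metapolys_subspace)
      (auto simp: meta_act_eq_mat_act mat_act_metapolys)
  moreover have "meta_act d k g p \<in> cmpoly.span ?O" if g: "g \<in> carrier (GL k)" and p: "p \<in> cmpoly.span ?O" for g p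
  proof -
    have "cmpoly.subspace {p. meta_act d k g p \<in> cmpoly.span ?O}"
      by (simp add: cmpoly.subspace_def meta_act_eq_mat_act[OF g] mat_act_add mat_act_cscale
          cmpoly.span_zero cmpoly.span_add cmpoly.span_scale)
    moreover have "?O \<subseteq> {p. meta_act d k g p \<in> cmpoly.span ?O}"
      using g by (auto simp: meta_act_meta_act intro!: cmpoly.span_base)
    ultimately show ?thesis using cmpoly.span_minimal p by blast
  qed
  ultimately show ?thesis
    by (auto simp: subrep_def orbit_span_def cmpoly.subspace_span)
qed

lemma self_in_orbit_span:
  assumes "\<Delta> \<in> metapolys \<delta> d k"
  shows "\<Delta> \<in> orbit_span d k \<Delta>"
proof -
  interpret group "GL k" by (rule group_GL)
  have "meta_act d k \<one>\<^bsub>GL k\<^esub> \<Delta> = mat_act d k (diag (\<lambda>_. 1)) \<Delta>"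
    unfolding meta_act_eq_mat_act[OF one_closed] unfolding GL_one
    by (rule fun_cong[OF mat_act_cong]) (auto simp: diag_def)
  then have "meta_act d k \<one>\<^bsub>GL k\<^esub> \<Delta> = \<Delta>" using mat_act_one[OF assms] by simp
  then show ?thesis
    unfolding orbit_span_def by (metis cmpoly.span_base image_eqI one_closed)
qed

text \<open>The coefficient vectors \<open>c \<alpha>\<close> bound the dimension but come without a
  circuit bound. The basis is therefore chosen among the translates, and the
  \<open>c \<alpha>\<close> only limit its size.\<close>

lemma orbit_span_lincomb:
  assumes "\<Delta> \<in> metapolys \<delta> d k" "p \<in> orbit_span d k \<Delta>"
  shows "\<exists>B u. finite B \<and> B \<subseteq> (\<lambda>g. meta_act d k g \<Delta>) ` carrier (GL k) \<and>
    card B \<le> card (mons ({..<k} \<times> {..<k}) (\<delta> * d)) \<and> p = (\<Sum>b\<in>B. cscale (u b) b)"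
proof -
  let ?O = "(\<lambda>g. meta_act d k g \<Delta>) ` carrier (GL k)" and ?M = "mons ({..<k} \<times> {..<k}) (\<delta> * d)"
  obtain c where c: "\<And>A. mat_act d k A \<Delta> = (\<Sum>\<alpha>\<in>?M. cscale (mon_val (\<lambda>(i, j). A i j) \<alpha>) (c \<alpha>))"
    using poly_dependent_mat_act[OF assms(1)] unfolding poly_dependent_def by metis
  have O: "?O \<subseteq> cmpoly.span (c ` ?M)"
    by (auto simp: meta_act_eq_mat_act c intro!: cmpoly.span_sum cmpoly.span_scale intro: cmpoly.span_base)
  obtain B where B: "B \<subseteq> ?O" "cmpoly.independent B" "?O \<subseteq> cmpoly.span B"
    using cmpoly.maximal_independent_subset by blast
  have "finite B \<and> card B \<le> card (c ` ?M)"
    using B O by (intro cmpoly.independent_span_bound) (auto simp: finite_mons)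
  moreover have "card (c ` ?M) \<le> card ?M" by (intro card_image_le finite_mons) auto
  moreover have "p \<in> cmpoly.span B"
    using assms(2) B(3) cmpoly.span_minimal[OF B(3) cmpoly.subspace_span] by (auto simp: orbit_span_def)
  ultimately show ?thesis
    using cmpoly.span_finite[of B] B(1) by (intro exI[of _ B]) auto
qed

section \<open>Vanishing and size bounds\<close>

lemma homogeneous_iff_mons: "homogeneous d f \<longleftrightarrow> Poly_Mapping.keys f \<subseteq> mons UNIV d"
  by (auto simp: homogeneous_def mons_def)

definition block_ext :: "nat \<Rightarrow> (nat \<Rightarrow> nat \<Rightarrow> complex) \<Rightarrow> nat \<Rightarrow> nat \<Rightarrow> complex" where
  "block_ext k A i j = (if i < k \<and> j < k then A i j else of_bool (i = j))"

lemma mmult_block_ext: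
  assumes "k \<le> K" "i < K" "j < K"
  shows "mmult K (block_ext k A) (block_ext k B) i j = block_ext k (mmult k A B) i j"
proof -
  consider "i < k" "j < k" | "i \<ge> k" | "i < k" "j \<ge> k" by linarith
  then show ?thesis
  proof cases
    case 1
    have "(\<Sum>l<K. block_ext k A i l * block_ext k B l j) = (\<Sum>l<k. block_ext k A i l * block_ext k B l j)"
      using assms(1) 1 by (intro sum.mono_neutral_right) (auto simp: block_ext_def)
    then show ?thesis using 1 by (simp add: mmult_def block_ext_def)
  next
    case 2
    then show ?thesis
      using assms unfolding mmult_def
      by (subst sum.remove[of _ i]) (auto simp: block_ext_def intro!: sum.neutral)
  next
    case 3
    then show ?thesis
      using assms unfolding mmult_def
      by (subst sum.remove[of _ j]) (auto simp: block_ext_def intro!: sum.neutral)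
  qed
qed

lemma block_ext_GL:
  assumes "g \<in> carrier (GL k)" "k \<le> K"
  shows "mat K K (\<lambda>(i, j). block_ext k (\<lambda>i j. g $$ (i, j)) i j) \<in> carrier (GL K)"
proof -
  let ?e = "\<lambda>g :: complex mat. mat K K (\<lambda>(i, j). block_ext k (\<lambda>i j. g $$ (i, j)) i j)"
  obtain h where h: "g \<in> carrier_mat k k" "h \<in> carrier_mat k k" "h * g = 1\<^sub>m k" "g * h = 1\<^sub>m k"
    using assms(1) by (auto simp: GL_iff)
  have "?e a * ?e b = 1\<^sub>m K" if "a \<in> carrier_mat k k" "b \<in> carrier_mat k k" "a * b = 1\<^sub>m k" for a b
  proof (rule eq_matI)
    fix i j assume ij: "i < dim_row (1\<^sub>m K)" "j < dim_col (1\<^sub>m K)"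
    then have "(?e a * ?e b) $$ (i, j)
        = mmult K (block_ext k (\<lambda>i j. a $$ (i, j))) (block_ext k (\<lambda>i j. b $$ (i, j))) i j"
      by (simp add: mmult_def scalar_prod_def lessThan_atLeast0)
    also have "\<dots> = block_ext k (mmult k (\<lambda>i j. a $$ (i, j)) (\<lambda>i j. b $$ (i, j))) i j"
      using assms(2) ij by (intro mmult_block_ext) auto
    also have "\<dots> = 1\<^sub>m K $$ (i, j)"
    proof (cases "i < k \<and> j < k")
      case True
      then have "mmult k (\<lambda>i j. a $$ (i, j)) (\<lambda>i j. b $$ (i, j)) i j = (a * b) $$ (i, j)"
        using that(1,2) by (auto simp: mmult_def scalar_prod_def lessThan_atLeast0)
      then show ?thesis using True that(3) ij by (simp add: block_ext_def)
    qed (use ij in \<open>auto simp: block_ext_def\<close>)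
    finally show "(?e a * ?e b) $$ (i, j) = 1\<^sub>m K $$ (i, j)" .
  qed auto
  then show ?thesis
    unfolding GL_iff using h by (auto intro!: bexI[of _ "?e h"])
qed

lemma lookup_var_mult_eq_0:
  assumes "i \<notin> Poly_Mapping.keys \<mu>"
  shows "Poly_Mapping.lookup (var i * q) \<mu> = 0"
proof -
  have "\<mu> \<notin> Poly_Mapping.keys (var i * q)"
  proof
    assume "\<mu> \<in> Poly_Mapping.keys (var i * q)"
    then obtain b where "\<mu> = Poly_Mapping.single i 1 + b"
      using keys_mult[of "var i" q] by (auto simp: var_def)
    then show False using assms by (simp add: in_keys_iff lookup_add)
  qed
  then show ?thesis by (simp add: in_keys_iff)
qed

text \<open>Truncating \<open>f\<close> to k variables could change \<open>c f\<close>, so the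
  number of variables is raised to \<open>K\<close> and \<open>g\<close> is extended by an identity
  block. The coefficients that \<open>\<Delta>\<close> reads are unaffected by the monomials of
  \<open>f\<close> involving further variables.\<close>

lemma meta_eval_meta_act_more_variables:
  assumes "invariant_measure c" "\<Delta> \<in> metapolys \<delta> d k" "g \<in> carrier (GL k)" "homogeneous d f"
  shows "\<exists>f'. homogeneous d f' \<and> c f' = c f \<and> meta_eval (meta_act d k g \<Delta>) f = meta_eval \<Delta> f'"
proof -
  have "finite (\<Union>m\<in>Poly_Mapping.keys f. Poly_Mapping.keys m)" by simp
  then obtain K' where K': "\<forall>i\<in>(\<Union>m\<in>Poly_Mapping.keys f. Poly_Mapping.keys m). i < K'"
    unfolding finite_nat_set_iff_bounded by blast
  define K where "K = max k K'"
  have K: "k \<le> K" and vars: "\<And>m i. m \<in> Poly_Mapping.keys f \<Longrightarrow> i \<in> Poly_Mapping.keys m \<Longrightarrow> i < K"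
    using K' by (force simp: K_def)+
  then have f: "f \<in> polys_in K" by (auto simp: polys_in_def)
  let ?A = "\<lambda>i j. g $$ (i, j)"
  let ?A' = "block_ext k ?A"
  let ?G = "mat K K (\<lambda>(i, j). ?A' i j)"
  have G: "?G \<in> carrier (GL K)" using block_ext_GL[OF assms(3) K] .
  interpret group "GL K" by (rule group_GL)
  let ?f = "gl_act K (inv\<^bsub>GL K\<^esub> ?G) f"
  have f': "?f = mp_subst (lin_form K ?A') f"
    unfolding gl_act_def inv_inv[OF G]
    by (rule mp_subst_cong) (use vars in \<open>auto simp: lin_form_def intro!: sum.cong\<close>)
  have "homogeneous d ?f"
    unfolding f' homogeneous_iff_mons
  proof (rule keys_mp_subst_mons)
    show "Poly_Mapping.keys f \<subseteq> mons UNIV d" using assms(4) by (simp add: homogeneous_iff_mons)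
    show "Poly_Mapping.keys (lin_form K ?A' v) \<subseteq> mons UNIV 1" for v
      using keys_lin_form[of K ?A' v] by (auto simp: mons_def)
  qed
  moreover have "c ?f = c f"
    using assms(1) f inv_closed[OF G] unfolding invariant_measure_def by blast
  moreover have "meta_eval (meta_act d k g \<Delta>) f = meta_eval \<Delta> ?f"
  proof -
    have "mp_eval (Poly_Mapping.lookup f) (coeff_form d k ?A \<mu>) = Poly_Mapping.lookup ?f \<mu>"
      if \<mu>: "\<mu> \<in> exponents d k" for \<mu>
    proof -
      have same: "mon_val (lin_form K ?A') \<nu> = mon_val (lin_form k ?A) \<nu>" if "\<nu> \<in> exponents d k" for \<nu>
      proof (rule mon_val_cong)
        fix i assume "i \<in> Poly_Mapping.keys \<nu>"
        then have "i < k" using that by (auto simp: exponents_def)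
        then have "lin_form K ?A' i = (\<Sum>j<k. const (?A' i j) * var j)"
          unfolding lin_form_def using K by (intro sum.mono_neutral_right) (auto simp: block_ext_def)
        then show "lin_form K ?A' i = lin_form k ?A i"
          using \<open>i < k\<close> by (simp add: lin_form_def block_ext_def)
      qed
      \<comment> \<open>A variable of index at least \<open>k\<close> is fixed by the block matrix
        and survives as a factor of the image of its monomial, so no exponent vector in the first k
        variables can occur there.\<close>
      have other: "Poly_Mapping.lookup (mon_val (lin_form K ?A') \<nu>) \<mu> = 0"
        if \<nu>: "\<nu> \<in> Poly_Mapping.keys f" "\<nu> \<notin> exponents d k" for \<nu>
      proof -
        have "mdeg \<nu> = d" using assms(4) \<nu>(1) by (simp add: homogeneous_def)
        then obtain i where i: "i \<in> Poly_Mapping.keys \<nu>" "i \<ge> k"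
          using \<nu>(2) by (force simp: exponents_def)
        have "lin_form K ?A' i = (\<Sum>j<K. if j = i then var j else 0)"
          unfolding lin_form_def using i(2) by (intro sum.cong) (auto simp: block_ext_def)
        also have "\<dots> = var i" using vars[OF \<nu>(1) i(1)] by simp
        finally have lin: "lin_form K ?A' i = var i" .
        obtain e where e: "Poly_Mapping.lookup \<nu> i = Suc e"
          using i(1) by (auto simp: in_keys_iff gr0_conv_Suc)
        have "mon_val (lin_form K ?A') \<nu> = var i * (var i ^ e *
            (\<Prod>v\<in>Poly_Mapping.keys \<nu> - {i}. lin_form K ?A' v ^ Poly_Mapping.lookup \<nu> v))"
          unfolding mon_val_def by (subst prod.remove[OF _ i(1)]) (auto simp: lin e mult.assoc)
        moreover have "i \<notin> Poly_Mapping.keys \<mu>" using \<mu> i(2) by (auto simp: exponents_def)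
        ultimately show ?thesis using lookup_var_mult_eq_0 by simp
      qed
      have "Poly_Mapping.lookup ?f \<mu> = (\<Sum>\<nu>\<in>Poly_Mapping.keys f \<union> exponents d k.
          Poly_Mapping.lookup f \<nu> * Poly_Mapping.lookup (mon_val (lin_form K ?A') \<nu>) \<mu>)"
        unfolding f' by (subst mp_subst_superset[of "Poly_Mapping.keys f \<union> exponents d k"])
          (auto simp: finite_exponents lookup_sum lookup_const_mult)
      also have "\<dots> = (\<Sum>\<nu>\<in>exponents d k.
          Poly_Mapping.lookup f \<nu> * Poly_Mapping.lookup (mon_val (lin_form K ?A') \<nu>) \<mu>)"
        using other by (intro sum.mono_neutral_right) (auto simp: finite_exponents)
      finally show ?thesis
        by (simp add: coeff_form_def mp_eval_sum mp_eval_mult same mult.commute)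
    qed
    then show ?thesis
      unfolding meta_act_eq_mat_act[OF assms(3)] meta_eval_def mat_act_def mp_eval_subst
      using assms(2) by (intro mp_eval_cong) (auto simp: metapolys_def)
  qed
  ultimately show ?thesis by blast
qed

lemma orbit_span_vanishes:
  assumes "invariant_measure c" "\<Delta> \<in> metapolys \<delta> d k" "p \<in> orbit_span d k \<Delta>"
    and "\<forall>f\<in>X_set c d r. meta_eval \<Delta> f = 0"
  shows "\<forall>f\<in>X_set c d r. meta_eval p f = 0"
proof -
  let ?Z = "{p. \<forall>f\<in>X_set c d r. meta_eval p f = 0}"
  have "cmpoly.subspace ?Z"
    by (auto simp: cmpoly.subspace_def meta_eval_def mp_eval_add mp_eval_mult cscale_def)
  moreover have "meta_eval (meta_act d k g \<Delta>) f = 0" if g: "g \<in> carrier (GL k)" and f: "f \<in> X_set c d r" for f g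
  proof -
    obtain f' where "homogeneous d f'" "c f' = c f" "meta_eval (meta_act d k g \<Delta>) f = meta_eval \<Delta> f'"
      using meta_eval_meta_act_more_variables[OF assms(1,2) g, of f] f
      by (auto simp: X_set_def)
    then show ?thesis using assms(4) f by (auto simp: X_set_def)
  qed
  ultimately have "orbit_span d k \<Delta> \<subseteq> ?Z"
    unfolding orbit_span_def by (intro cmpoly.span_minimal) auto
  then show ?thesis using assms(3) by blast
qed

lemma cc_orbit_span_le:
  assumes "\<Delta> \<in> metapolys \<delta> d k" "p \<in> orbit_span d k \<Delta>"
  shows "cc p \<le> card (mons ({..<k} \<times> {..<k}) (\<delta> * d)) * (cc \<Delta> + 1) + 1"
proof -
  obtain B u where B: "finite B" "B \<subseteq> (\<lambda>g. meta_act d k g \<Delta>) ` carrier (GL k)"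
    "card B \<le> card (mons ({..<k} \<times> {..<k}) (\<delta> * d))" "p = (\<Sum>b\<in>B. cscale (u b) b)"
    using orbit_span_lincomb[OF assms] by blast
  have \<Delta>: "has_circuit (cc \<Delta>) \<Delta>" using ex_has_circuit has_circuit_cc by blast
  have "Poly_Mapping.keys (coeff_form d k A \<mu>) \<subseteq> mons UNIV 1" for A \<mu>
    using keys_coeff_form[of d k A \<mu>] by (auto simp: mons_def)
  then have "has_circuit (cc \<Delta>) (meta_act d k g \<Delta>)" if "g \<in> carrier (GL k)" for g
    unfolding meta_act_eq_mat_act[OF that] mat_act_def
    by (intro has_circuit_subst[OF \<Delta>] affine_linear_subst)
  then have "has_circuit (card B * (cc \<Delta> + 1) + 1) p"
    unfolding B(4) using B(2) by (intro has_circuit_sum_cscale B(1)) auto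
  then have "cc p \<le> card B * (cc \<Delta> + 1) + 1" by (rule cc_le)
  also have "\<dots> \<le> card (mons ({..<k} \<times> {..<k}) (\<delta> * d)) * (cc \<Delta> + 1) + 1"
    using B(3) by (intro add_right_mono mult_right_mono) auto
  finally show ?thesis .
qed

lemma ex_isotypic_in_orbit_span:
  assumes "\<Delta> \<in> metapolys \<delta> d k" "\<Delta> \<noteq> 0"
  shows "\<exists>p\<in>orbit_span d k \<Delta>. p \<noteq> 0 \<and>
    (\<exists>l\<in>partitions (\<delta> * d) k. p \<in> isotypic_component \<delta> d k l)"
proof -
  have "orbit_span d k \<Delta> \<noteq> {0}" using self_in_orbit_span[OF assms(1)] assms(2) by blast
  then obtain U where U: "U \<subseteq> orbit_span d k \<Delta>" "irreducible_subrep \<delta> d k U"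
    using ex_irreducible_subrep[OF subrep_orbit_span[OF assms(1)]] by blast
  then have "subrep \<delta> d k U" "U \<noteq> {0}" by (auto simp: irreducible_subrep_def)
  then obtain l p where l: "l \<in> partitions (\<delta> * d) k" "p \<in> U" "highest_weight_vector d k l p"
    using ex_highest_weight_vector by blast
  then have "p \<in> isotypic_component \<delta> d k l"
    unfolding isotypic_component_def using U(2) by (intro cmpoly.span_base) blast
  then show ?thesis
    using l U(1) by (auto simp: highest_weight_vector_def)
qed

section \<open>Quasipolynomial bounds\<close>

lemma nat_poly_le:
  fixes p :: "nat poly"
  shows "\<exists>C e. \<forall>n. poly p n \<le> C * (n + 1) ^ e"
proof (induction p)
  case 0
  then show ?case by (intro exI[of _ 0]) auto
next
  case (pCons a p)
  then obtain C e where Ce: "\<And>n. poly p n \<le> C * (n + 1) ^ e" by blast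
  have "poly (pCons a p) n \<le> (a + C) * (n + 1) ^ Suc e" for n
  proof -
    have "n * poly p n \<le> (n + 1) * (C * (n + 1) ^ e)" using Ce by (intro mult_mono) auto
    moreover have "1 \<le> (n + 1) ^ Suc e" by (rule one_le_power) simp
    then have "a * 1 \<le> a * (n + 1) ^ Suc e" by (rule mult_left_mono) simp
    ultimately show ?thesis by (simp add: algebra_simps)
  qed
  then show ?case by blast
qed

text \<open>The exponent polynomial in \<open>metaVQP\<close> may take negative values. A
  nonnegative majorant makes the corresponding power of 2 at least 1.\<close>

lemma real_poly_le:
  fixes p :: "real poly"
  shows "\<exists>C\<ge>0. \<exists>e. \<forall>x\<ge>0. poly p x \<le> C * (x + 1) ^ e"
proof (induction p)
  case 0
  then show ?case by (intro exI[of _ 0]) auto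
next
  case (pCons a p)
  then obtain C e where Ce: "C \<ge> 0" "\<And>x. x \<ge> 0 \<Longrightarrow> poly p x \<le> C * (x + 1) ^ e" by blast
  have "poly (pCons a p) x \<le> (\<bar>a\<bar> + C) * (x + 1) ^ Suc e" if "x \<ge> 0" for x
  proof -
    have "x * poly p x \<le> x * (C * (x + 1) ^ e)" using Ce that by (intro mult_left_mono) auto
    also have "\<dots> \<le> (x + 1) * (C * (x + 1) ^ e)" using Ce that by (intro mult_right_mono) auto
    finally have "x * poly p x \<le> C * (x + 1) ^ Suc e" by (simp add: mult_ac)
    moreover have "\<bar>a\<bar> * 1 \<le> \<bar>a\<bar> * (x + 1) ^ Suc e"
      using that by (intro mult_left_mono one_le_power) auto
    ultimately show ?thesis by (simp add: distrib_right)
  qed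
  then show ?case using Ce(1) by (intro exI[of _ "\<bar>a\<bar> + C"] conjI exI[of _ "Suc e"]) auto
qed

text \<open>For a \<le> b the binomial coefficient is at least ((a + b) / a)^a, hence at least 2^a.
  With a = k - 1 and b = n this bounds the smaller of the two by log N.\<close>

lemma power2_le_choose:
  assumes "m \<le> a" "m \<le> b"
  shows "2 ^ m \<le> real ((a + b) choose b)"
proof -
  have *: "2 ^ a \<le> real ((a + b) choose a)" if "a \<le> b" for a b
  proof (cases "a = 0")
    case False
    then have "2 \<le> real (a + b) / real a" using that by (simp add: field_simps)
    then have "2 ^ a \<le> (real (a + b) / real a) ^ a" by (intro power_mono) auto
    also have "\<dots> \<le> real ((a + b) choose a)" using binomial_ge_n_over_k_pow_k[of a "a + b"] by auto
    finally show ?thesis .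
  qed simp
  have "(2::real) ^ m \<le> 2 ^ min a b" using assms by (intro power_increasing) auto
  also have "\<dots> \<le> real ((a + b) choose b)"
  proof (cases "a \<le> b")
    case True
    then show ?thesis using *[of a b] binomial_symmetric[of a "a + b"] by simp
  next
    case False
    then show ?thesis using *[of b a] by (simp add: add.commute)
  qed
  finally show ?thesis .
qed

text \<open>The count is at most (\<delta> n + 1)^(k^2). Here log (\<delta> n + 1) is linear in log
  N, because \<delta> is polynomial in N and n < N once k \<ge> 2, and k is polynomial in log
  N.\<close>

lemma orbit_dimension_le:
  assumes "poly_bounded k" and \<delta>: "\<And>n. \<delta> n \<le> poly p ((k n + n - 1) choose n)"
  shows "\<exists>C\<ge>0. \<exists>e. \<forall>n. real (card (mons ({..<k n} \<times> {..<k n}) (\<delta> n * n)))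
     \<le> 2 powr (C * (log 2 (real ((k n + n - 1) choose n)) + 1) ^ e)"
proof -
  obtain q where q: "\<And>n. k n \<le> poly q n" using assms(1) by (auto simp: poly_bounded_def)
  obtain C1 e1 where C1: "\<And>n. poly p n \<le> C1 * (n + 1) ^ e1" using nat_poly_le by blast
  obtain C2 e2 where C2: "\<And>n. poly q n \<le> C2 * (n + 1) ^ e2" using nat_poly_le by blast
  \<comment> \<open>The square of the constant bounding \<open>k n\<close> times the constant
    bounding the logarithm of \<delta> n + 1. The exponent is likewise 2 (e2 + 1) + 1.\<close>
  define C :: real where "C = (real C2 + 1)\<^sup>2 * (real C1 + real e1 + 2)"
  have "real (card (mons ({..<k n} \<times> {..<k n}) (\<delta> n * n)))
     \<le> 2 powr (C * (log 2 (real ((k n + n - 1) choose n)) + 1) ^ (2 * e2 + 3))" for n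
  proof -
    define N where "N = (k n + n - 1) choose n"
    define L where "L = log 2 (real N)"
    \<comment> \<open>For \<open>k n = 0\<close> and n > 0 the binomial coefficient is 0, and
      \<open>log 2 0\<close> is 0 by convention.\<close>
    have L: "L \<ge> 0" unfolding L_def by (cases "N = 0") (auto simp: log_def)
    let ?c = "card (mons ({..<k n} \<times> {..<k n}) (\<delta> n * n))"
    have C: "C \<ge> 0" by (simp add: C_def)
    show ?thesis
    proof (cases "k n \<le> 1")
      case True
      then have "?c \<le> 1" by (intro card_mons_le_1[of _ "(0, 0)"]) auto
      moreover have "1 \<le> 2 powr (C * (L + 1) ^ (2 * e2 + 3))"
        using C L by (intro ge_one_powr_ge_zero) auto
      ultimately show ?thesis unfolding L_def N_def by linarith
    next
      case False
      define K where "K = k n - 1"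
      have K: "k n = K + 1" "K \<ge> 1" using False by (auto simp: K_def)
      have N: "N = (K + n) choose n" by (simp add: N_def K)
      have "(1 + n) choose n \<le> N" unfolding N using K(2) by (intro binomial_right_mono) auto
      then have nN: "n + 1 \<le> N" by simp
      \<comment> \<open>If \<open>K \<le> n\<close>, then \<open>K\<close> itself is at most log N.
        Otherwise n is, and \<open>k n\<close> is bounded through its polynomial bound in n. The
        exponent \<open>e2 + 1\<close> covers both cases.\<close>
      have k_le: "real (k n) \<le> (real C2 + 1) * (L + 1) ^ (e2 + 1)"
      proof (cases "K \<le> n")
        case True
        have "2 ^ K \<le> real N" unfolding N by (rule power2_le_choose) (use True in auto)
        then have "real K \<le> L" unfolding L_def using nN by (simp add: le_log_of_power)
        then have "real (k n) \<le> 1 * (L + 1) ^ 1" by (simp add: K)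
        also have "\<dots> \<le> (real C2 + 1) * (L + 1) ^ (e2 + 1)"
          using L by (intro mult_mono power_increasing) auto
        finally show ?thesis .
      next
        case False
        have "2 ^ n \<le> real N" unfolding N by (rule power2_le_choose) (use False in auto)
        then have nL: "real n \<le> L" unfolding L_def using nN by (simp add: le_log_of_power)
        have "real (k n) \<le> real (C2 * (n + 1) ^ e2)"
          using q[of n] C2[of n] unfolding of_nat_le_iff by linarith
        also have "\<dots> = real C2 * (real n + 1) ^ e2" by (simp add: add.commute)
        also have "\<dots> \<le> (real C2 + 1) * (L + 1) ^ e2" using nL by (intro mult_mono power_mono) auto
        also have "\<dots> \<le> (real C2 + 1) * (L + 1) ^ (e2 + 1)"
          using L by (intro mult_left_mono power_increasing) auto
        finally show ?thesis .
      qed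
      define D where "D = \<delta> n * n + 1"
      have D_pos: "D > 0" by (simp add: D_def)
      have log_D: "log 2 (real D) \<le> (real C1 + real e1 + 2) * (L + 1)"
      proof -
        have "\<delta> n * n \<le> (C1 * (N + 1) ^ e1) * (N + 1)"
          using \<delta>[of n] C1[of N] nN unfolding N_def by (intro mult_mono) auto
        moreover have "1 \<le> (N + 1) ^ Suc e1" by (rule one_le_power) simp
        ultimately have "D \<le> (C1 + 1) * (N + 1) ^ Suc e1" by (simp add: D_def algebra_simps)
        \<comment> \<open>Rounded up to factors whose logarithms are immediate, by
          \<open>C1 + 1 \<le> 2 ^ (C1 + 1)\<close> and \<open>N + 1 \<le> 2 * N\<close>.\<close>
        also have "\<dots> \<le> 2 ^ (C1 + 1) * (2 * N) ^ Suc e1"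
          using nN by (intro mult_mono power_mono less_imp_le[OF less_exp]) auto
        finally have "real D \<le> real (2 ^ (C1 + 1) * (2 * N) ^ Suc e1)" unfolding of_nat_le_iff .
        then have "log 2 (real D) \<le> log 2 (2 ^ (C1 + 1) * (2 * real N) ^ Suc e1)"
          using D_pos by (intro log_mono) auto
        also have "\<dots> = real (C1 + 1) + real (Suc e1) * (1 + L)"
          using nN by (simp add: log_mult log_nat_power L_def algebra_simps del: power_Suc)
        also have "\<dots> \<le> (real C1 + real e1 + 2) * (L + 1)"
        proof -
          have "real (C1 + 1) * 1 \<le> real (C1 + 1) * (L + 1)" using L by (intro mult_left_mono) auto
          then show ?thesis by (simp add: algebra_simps)
        qed
        finally show ?thesis .
      qed
      have "?c \<le> D ^ card ({..<k n} \<times> {..<k n})" unfolding D_def by (rule card_mons_le) simp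
      also have "\<dots> = D ^ ((k n)\<^sup>2)" by (simp add: card_cartesian_product power2_eq_square)
      finally have "real ?c \<le> real (D ^ ((k n)\<^sup>2))" unfolding of_nat_le_iff .
      also have "\<dots> = (2 powr log 2 (real D)) ^ ((k n)\<^sup>2)" using D_pos by simp
      also have "\<dots> = 2 powr ((real (k n))\<^sup>2 * log 2 (real D))"
        by (simp add: powr_realpow[symmetric] powr_powr mult.commute)
      also have "\<dots> \<le> 2 powr (C * (L + 1) ^ (2 * e2 + 3))"
      proof -
        have "(real (k n))\<^sup>2 * log 2 (real D)
            \<le> ((real C2 + 1) * (L + 1) ^ (e2 + 1))\<^sup>2 * ((real C1 + real e1 + 2) * (L + 1))"
          using k_le log_D by (intro mult_mono power_mono) (use D_pos L in auto)
        also have "\<dots> = C * (L + 1) ^ Suc ((e2 + 1) * 2)"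
          unfolding C_def power_mult_distrib power_Suc2 power_mult by (simp only: mult_ac)
        also have "Suc ((e2 + 1) * 2) = 2 * e2 + 3" by simp
        finally show ?thesis by simp
      qed
      finally show ?thesis by (simp add: L_def N_def)
    qed
  qed
  then show ?thesis by (intro exI[of _ C] conjI exI[of _ "2 * e2 + 3"]) (auto simp: C_def)
qed

theorem theorem2p4:
  fixes c :: "cpoly \<Rightarrow> nat" and C :: "(nat \<Rightarrow> cpoly) set"
  assumes "invariant_measure c"
    and "C = {g. p_family g \<and> poly_bounded (\<lambda>n. c (g n))}"
  shows "(\<exists>D \<in> vanishing_seqs c \<inter> metaVQP. \<not> eventually_zero D) \<longleftrightarrow>
         (\<exists>D \<in> vanishing_seqs c \<inter> metaVQP \<inter> isotypic_seqs. \<not> eventually_zero D)"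
proof
  assume "\<exists>D \<in> vanishing_seqs c \<inter> metaVQP. \<not> eventually_zero D"
  then obtain \<delta> k \<Delta> where D: "(\<delta>, k, \<Delta>) \<in> vanishing_seqs c" "(\<delta>, k, \<Delta>) \<in> metaVQP"
    "\<not> eventually_zero (\<delta>, k, \<Delta>)"
    by auto
  define N where "N n = (k n + n - 1) choose n" for n
  have \<Delta>: "\<Delta> n \<in> metapolys (\<delta> n) n (k n)" for n
    using D(2) by (auto simp: metaVQP_def metaseqs_def)
  obtain p q where k: "poly_bounded k" and p: "\<And>n. \<delta> n \<le> poly p (N n)"
    and q: "\<And>n. real (cc (\<Delta> n)) \<le> 2 powr poly q (log 2 (real (N n)))"
    using D(2) by (auto simp: metaVQP_def N_def)
  \<comment> \<open>The degree is reset to \<open>0\<close> where \<open>\<Delta> n = 0\<close>: for \<open>k n = 0\<close> there is no partition of a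
    positive number with at most \<open>k n\<close> parts.\<close>
  define \<delta>' where "\<delta>' n = (if \<Delta> n = 0 then 0 else \<delta> n)" for n
  have "\<exists>\<Delta>'. \<Delta>' \<in> orbit_span n (k n) (\<Delta> n) \<and> (\<Delta>' = 0 \<longleftrightarrow> \<Delta> n = 0) \<and>
      (\<exists>l\<in>partitions (\<delta>' n * n) (k n). \<Delta>' \<in> isotypic_component (\<delta>' n) n (k n) l)" for n
  proof (cases "\<Delta> n = 0")
    case True
    have "(\<lambda>_. 0) \<in> partitions 0 (k n)" by (auto simp: partitions_def monotone_def)
    then show ?thesis
      using True by (intro exI[of _ 0])
        (auto simp: \<delta>'_def orbit_span_def isotypic_component_def cmpoly.span_zero)
  next
    case False
    then show ?thesis
      using ex_isotypic_in_orbit_span[OF \<Delta>[of n]] by (auto simp: \<delta>'_def)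
  qed
  then obtain \<Delta>' where orbit: "\<And>n. \<Delta>' n \<in> orbit_span n (k n) (\<Delta> n)"
    and zero: "\<And>n. \<Delta>' n = 0 \<longleftrightarrow> \<Delta> n = 0"
    and iso: "\<And>n. \<exists>l\<in>partitions (\<delta>' n * n) (k n). \<Delta>' n \<in> isotypic_component (\<delta>' n) n (k n) l"
    by metis
  have "\<Delta>' n \<in> metapolys (\<delta>' n) n (k n)" for n
    using subrep_metapolys[OF subrep_orbit_span[OF \<Delta>] orbit, of n] zero[of n]
    \<comment> \<open>The zero metapolynomial is homogeneous of every degree, so resetting the
      degree keeps the format valid.\<close>
    by (auto simp: \<delta>'_def metapolys_def homogeneous_def)
  then have seq: "(\<delta>', k, \<Delta>') \<in> metaseqs" by (simp add: metaseqs_def)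
  have "(\<delta>', k, \<Delta>') \<in> isotypic_seqs"
    using seq iso by (simp add: isotypic_seqs_def)
  moreover have "(\<delta>', k, \<Delta>') \<in> vanishing_seqs c"
    using seq D(1) orbit_span_vanishes[OF assms(1) \<Delta> orbit]
    by (auto simp: vanishing_seqs_def elim!: eventually_mono)
  moreover have "(\<delta>', k, \<Delta>') \<in> metaVQP"
  proof -
    obtain C1 e1 where C1: "C1 \<ge> 0" "\<And>n. real (card (mons ({..<k n} \<times> {..<k n}) (\<delta> n * n)))
        \<le> 2 powr (C1 * (log 2 (real (N n)) + 1) ^ e1)"
      using orbit_dimension_le[OF k, of \<delta> p] p by (auto simp: N_def)
    obtain C2 e2 where C2: "C2 \<ge> 0" "\<And>x. x \<ge> 0 \<Longrightarrow> poly q x \<le> C2 * (x + 1) ^ e2"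
      using real_poly_le[of q] by blast
    \<comment> \<open>With a and b the bounds for dimension and circuit size, both at least 1, one
      has a (b + 1) + 1 \<le> 4 a b; the summand 2 is the logarithm of 4.\<close>
    define r where "r = [:C1:] * [:1, 1:] ^ e1 + [:C2:] * [:1, 1:] ^ e2 + [:2:]"
    have "real (cc (\<Delta>' n)) \<le> 2 powr poly r (log 2 (real (N n)))" for n
    proof -
      define L where "L = log 2 (real (N n))"
      have L: "L \<ge> 0" unfolding L_def by (cases "N n = 0") (auto simp: log_def)
      define a where "a = 2 powr (C1 * (L + 1) ^ e1)"
      define b where "b = 2 powr (C2 * (L + 1) ^ e2)"
      have a: "a \<ge> 1" "real (card (mons ({..<k n} \<times> {..<k n}) (\<delta> n * n))) \<le> a"
        using C1 L by (auto simp: a_def L_def intro!: ge_one_powr_ge_zero)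
      have "2 powr poly q L \<le> b" using C2(2)[OF L] by (simp add: b_def)
      then have b: "real (cc (\<Delta> n)) \<le> b" "b \<ge> 1"
        using q[of n] C2(1) L by (simp add: L_def) (auto simp: b_def C2(1) L intro!: ge_one_powr_ge_zero)
      have "real (cc (\<Delta>' n))
          \<le> real (card (mons ({..<k n} \<times> {..<k n}) (\<delta> n * n)) * (cc (\<Delta> n) + 1) + 1)"
        using cc_orbit_span_le[OF \<Delta> orbit, of n] unfolding of_nat_le_iff .
      also have "\<dots> = real (card (mons ({..<k n} \<times> {..<k n}) (\<delta> n * n))) * (real (cc (\<Delta> n)) + 1) + 1"
        by (simp add: algebra_simps)
      also have "\<dots> \<le> a * (b + 1) + 1" using a b by (intro add_right_mono mult_mono) auto
      also have "\<dots> \<le> a * b * 4"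
      proof -
        have "a \<le> a * b" using mult_left_mono[of 1 b a] a b by simp
        moreover have "a * (b + 1) + 1 = a * b + a + 1" by (simp add: distrib_left)
        ultimately show ?thesis using a(1) by linarith
      qed
      also have "\<dots> = 2 powr poly r L"
        by (simp add: a_def b_def r_def powr_add add.commute)
      finally show ?thesis by (simp add: L_def)
    qed
    moreover have "\<delta>' n \<le> poly p (N n)" for n using p[of n] by (simp add: \<delta>'_def)
    ultimately show ?thesis using seq k by (auto simp: metaVQP_def N_def)
  qed
  moreover have "\<not> eventually_zero (\<delta>', k, \<Delta>')"
    using D(3) by (simp add: eventually_zero_def zero)
  ultimately show "\<exists>D \<in> vanishing_seqs c \<inter> metaVQP \<inter> isotypic_seqs. \<not> eventually_zero D"
    by blast
qed auto

end
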